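(* Let $S$ be a subsemigroup of $(M_n(\mathbb{C}),+)$ and assume that $M \mapsto \exp(M)$ is a homomorphism from $(S,+)$ to $(\mathrm{GL}_n(\mathbb{C}),\times)$, i.e. $\exp(A+B)=\exp(A)\exp(B)$ for all $A,B\in S$. Then the linear span $\mathrm{Span}(S)$ of $S$ in $M_n(\mathbb{C})$ has property L.
   Context: A linear subspace $V$ of $M_n(\mathbb{C})$ has property L if there exist $n$ linear forms $f_1,\dots,f_n$ on $V$ such that for every $M \in V$, the characteristic polynomial of $M$ equals $\prod_{k=1}^n (X - f_k(M))$ (i.e. the eigenvalues of $M$ counted with algebraic multiplicity are $f_1(M),\dots,f_n(M)$). *)

theory Defs
  imports Complex_Main "Jordan_Normal_Form.Char_Poly"
begin

definition mexp :: "complex mat \<Rightarrow> complex mat" where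
  "mexp M = mat (dim_row M) (dim_col M)
     (\<lambda>(i,j). (\<Sum>k. (M ^\<^sub>m k) $$ (i,j) / of_nat (fact k)))"

inductive_set mspan :: "nat \<Rightarrow> complex mat set \<Rightarrow> complex mat set"
  for n :: nat and S :: "complex mat set" where
  zero: "0\<^sub>m n n \<in> mspan n S"
| add: "A \<in> S \<Longrightarrow> B \<in> mspan n S \<Longrightarrow> c \<cdot>\<^sub>m A + B \<in> mspan n S"

definition linear_form_on :: "complex mat set \<Rightarrow> (complex mat \<Rightarrow> complex) \<Rightarrow> bool" where
  "linear_form_on V f \<longleftrightarrow>
     (\<forall>A\<in>V. \<forall>B\<in>V. f (A + B) = f A + f B) \<and>
     (\<forall>A\<in>V. \<forall>c. f (c \<cdot>\<^sub>m A) = c * f A)"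

definition property_L :: "nat \<Rightarrow> complex mat set \<Rightarrow> bool" where
  "property_L n V \<longleftrightarrow>
     (\<exists>f :: nat \<Rightarrow> complex mat \<Rightarrow> complex.
        (\<forall>k<n. linear_form_on V (f k)) \<and>
        (\<forall>M\<in>V. char_poly M = (\<Prod>k<n. [: - f k M, 1 :])))"

end

theory Submission
  imports Defs "HOL-Analysis.Analysis"
begin

text \<open>
  The matrices \<open>exp A\<close> with \<open>A \<in> S\<close> commute. For \<open>A, B \<in> S\<close> let \<open>y(u)\<close> be a smooth
  branch of eigenvalues of \<open>A + u B\<close>, \<open>u > 0\<close>. If \<open>K, L, s\<close> are integers, then \<open>K y((L + s)/K)\<close>
  is an eigenvalue of \<open>K A + (L + s) B\<close>, so its exponential is \<open>\<alpha> \<beta>\<^sup>s\<close> with eigenvalues \<open>\<alpha>\<close> of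
  \<open>exp (K A + L B)\<close> and \<open>\<beta>\<close> of \<open>exp B\<close>. Among more than \<open>n\<^sup>2\<close> values of \<open>s\<close> two share the pair
  \<open>(\<alpha>, \<beta>)\<close>; with \<open>L/K\<close> tending to \<open>u\<close> this gives \<open>exp (d y'(u)) = \<beta>\<^sup>d\<close> for some
  \<open>1 \<le> d \<le> n\<^sup>2\<close>. So the continuous function \<open>y'\<close> takes countably many values, hence \<open>y\<close> is affine,
  and the characteristic polynomial of \<open>A + u B\<close> is a product of factors \<open>X - c\<^sub>j - u d\<^sub>j\<close>.
  A Zariski density argument extends this to combinations of several elements of \<open>S\<close>, finitely
  many of which span. The resulting linear forms are well defined on the span because \<open>0\<close> is the only
  eigenvalue of the zero matrix.
\<close>

unbundle no vec_syntax

hide_const (open) Finite_Cartesian_Product.vec Finite_Cartesian_Product.mat Determinants.det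
  module.smult
hide_type (open) Finite_Cartesian_Product.vec

section \<open>Eigenvectors of commuting matrices\<close>

text \<open>Applied with \<open>a k\<close> an entry of the k-th iterate of a vector
  \<open>w\<close> under \<open>T\<close>: it moves a linear factor of an annihilating polynomial
  onto the vector \<open>T w - c w\<close>.\<close>

lemma coeff_linear_times:
  fixes q :: "complex poly"
  assumes "degree q \<le> N"
  shows "(\<Sum>k\<le>Suc N. coeff ([:-c, 1:] * q) k * a k) = (\<Sum>k\<le>N. coeff q k * (a (Suc k) - c * a k))"
proof -
  have p: "[:-c, 1:] * q = pCons 0 q - smult c q" by simp
  have "(\<Sum>k\<le>Suc N. coeff ([:-c, 1:] * q) k * a k)
      = (\<Sum>k\<le>Suc N. coeff (pCons 0 q) k * a k) - (\<Sum>k\<le>Suc N. c * coeff q k * a k)"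
    unfolding p by (simp add: algebra_simps sum_subtractf)
  also have "(\<Sum>k\<le>Suc N. coeff (pCons 0 q) k * a k) = (\<Sum>k\<le>N. coeff q k * a (Suc k))"
    by (subst sum.atMost_Suc_shift) simp
  also have "(\<Sum>k\<le>Suc N. c * coeff q k * a k) = (\<Sum>k\<le>N. c * coeff q k * a k)"
    using assms by (simp add: coeff_eq_0)
  finally show ?thesis by (simp add: algebra_simps sum_subtractf)
qed

lemma pow_mat_mult_vec_diff:
  fixes T :: "complex mat"
  assumes T: "T \<in> carrier_mat n n" and w: "w \<in> carrier_vec n" and i: "i < n"
  shows "((T ^\<^sub>m k) *\<^sub>v (T *\<^sub>v w - c \<cdot>\<^sub>v w)) $ i
    = ((T ^\<^sub>m Suc k) *\<^sub>v w) $ i - c * ((T ^\<^sub>m k) *\<^sub>v w) $ i"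
proof -
  have Tk: "T ^\<^sub>m k \<in> carrier_mat n n" using T by simp
  have "(T ^\<^sub>m k) *\<^sub>v (T *\<^sub>v w - c \<cdot>\<^sub>v w) = (T ^\<^sub>m k) *\<^sub>v (T *\<^sub>v w) - (T ^\<^sub>m k) *\<^sub>v (c \<cdot>\<^sub>v w)"
    by (rule mult_minus_distrib_mat_vec[OF Tk]) (use T w in auto)
  also have "(T ^\<^sub>m k) *\<^sub>v (T *\<^sub>v w) = (T ^\<^sub>m Suc k) *\<^sub>v w"
    using assoc_mult_mat_vec[OF Tk T w] by simp
  also have "(T ^\<^sub>m k) *\<^sub>v (c \<cdot>\<^sub>v w) = c \<cdot>\<^sub>v ((T ^\<^sub>m k) *\<^sub>v w)"
    by (rule mult_mat_vec[OF Tk w])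
  finally show ?thesis using Tk T w i by (simp del: pow_mat.simps)
qed

text \<open>Induction on the degree of a polynomial with p(T) w = 0. Split off a root c of p: either
  \<open>T w - c w\<close> is zero and w is an eigenvector, or it is a nonzero vector of
  \<open>E\<close> annihilated by the cofactor. Closure of \<open>E\<close> is stated for exactly
  the operation of this descent.\<close>

lemma eigenvector_from_annihilator:
  fixes T :: "complex mat"
  assumes T: "T \<in> carrier_mat n n" and E: "E \<subseteq> carrier_vec n"
    and closed: "\<And>w c. w \<in> E \<Longrightarrow> T *\<^sub>v w - c \<cdot>\<^sub>v w \<in> E"
  shows "\<lbrakk>p \<noteq> 0; degree p = N; w \<in> E; w \<noteq> 0\<^sub>v n;
      \<forall>i<n. (\<Sum>k\<le>N. coeff p k * ((T ^\<^sub>m k) *\<^sub>v w) $ i) = 0\<rbrakk>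
    \<Longrightarrow> \<exists>w\<in>E. \<exists>c. w \<noteq> 0\<^sub>v n \<and> T *\<^sub>v w = c \<cdot>\<^sub>v w"
proof (induction N arbitrary: p w)
  case 0
  have w: "w \<in> carrier_vec n" using E 0 by auto
  have "coeff p 0 \<noteq> 0" using 0 by (metis leading_coeff_0_iff)
  moreover have "T ^\<^sub>m 0 *\<^sub>v w = w" using T w by simp
  ultimately have "\<forall>i<n. w $ i = 0" using 0(5) by simp
  hence "w = 0\<^sub>v n" using w by (intro eq_vecI) auto
  thus ?case using 0 by simp
next
  case (Suc N)
  have w: "w \<in> carrier_vec n" using E Suc by auto
  have "\<not> constant (poly p)" using Suc.prems by (simp add: constant_degree)
  then obtain c where "poly p c = 0" using fundamental_theorem_of_algebra by blast
  then obtain q where p: "p = [:-c, 1:] * q" by (metis poly_eq_0_iff_dvd dvdE)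
  have q: "q \<noteq> 0" using p Suc.prems by auto
  have "degree p = Suc (degree q)" unfolding p using q by (subst degree_mult_eq) auto
  hence dq: "degree q = N" using Suc.prems by simp
  define w' where "w' = T *\<^sub>v w - c \<cdot>\<^sub>v w"
  have w'E: "w' \<in> E" unfolding w'_def by (rule closed) fact
  show ?case
  proof (cases "w' = 0\<^sub>v n")
    case True
    have "T *\<^sub>v w = c \<cdot>\<^sub>v w"
    proof (rule eq_vecI)
      fix i assume "i < dim_vec (c \<cdot>\<^sub>v w)"
      hence i: "i < n" using w by simp
      have "w' $ i = 0" using True i by simp
      thus "(T *\<^sub>v w) $ i = (c \<cdot>\<^sub>v w) $ i" unfolding w'_def using i w T by simp
    qed (use w T in auto)
    thus ?thesis using Suc.prems by blast
  next
    case False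
    have "\<forall>i<n. (\<Sum>k\<le>N. coeff q k * ((T ^\<^sub>m k) *\<^sub>v w') $ i) = 0"
    proof (intro allI impI)
      fix i assume i: "i < n"
      have "(\<Sum>k\<le>N. coeff q k * ((T ^\<^sub>m k) *\<^sub>v w') $ i)
        = (\<Sum>k\<le>Suc N. coeff p k * ((T ^\<^sub>m k) *\<^sub>v w) $ i)"
        unfolding w'_def p pow_mat_mult_vec_diff[OF T w i]
        by (rule coeff_linear_times[symmetric]) (simp add: dq)
      thus "(\<Sum>k\<le>N. coeff q k * ((T ^\<^sub>m k) *\<^sub>v w') $ i) = 0"
        using Suc.prems(5) i by simp
    qed
    from Suc.IH[OF q dq w'E False this] show ?thesis .
  qed
qed

text \<open>The n + 1 vectors w, T w, ..., T^n w are linearly dependent; a dependence relation is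
  the coefficient list of \<open>p\<close>.\<close>

lemma exists_annihilator:
  fixes T :: "complex mat"
  assumes T: "T \<in> carrier_mat n n" and w: "w \<in> carrier_vec n"
  obtains p where "p \<noteq> 0" "\<forall>i<n. (\<Sum>k\<le>degree p. coeff p k * ((T ^\<^sub>m k) *\<^sub>v w) $ i) = 0"
proof -
  \<comment> \<open>A zero row below the n coordinate rows makes the matrix square. Every Leibniz
    product then contains an entry of that row.\<close>
  define M where "M = mat (Suc n) (Suc n) (\<lambda>(i,j). if i < n then ((T ^\<^sub>m j) *\<^sub>v w) $ i else 0)"
  have M: "M \<in> carrier_mat (Suc n) (Suc n)" unfolding M_def by simp
  have "(\<Prod>i = 0..<Suc n. M $$ (i, p i)) = 0" if "p permutes {0..<Suc n}" for p
  proof (rule prod_zero)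
    have "p n < Suc n" using permutes_in_image[OF that, of n] by simp
    hence "M $$ (n, p n) = 0" unfolding M_def by simp
    thus "\<exists>i\<in>{0..<Suc n}. M $$ (i, p i) = 0" by force
  qed simp
  hence "det M = 0" unfolding det_def'[OF M] by (intro sum.neutral) simp
  then obtain v where v: "v \<in> carrier_vec (Suc n)" "v \<noteq> 0\<^sub>v (Suc n)" "M *\<^sub>v v = 0\<^sub>v (Suc n)"
    using det_0_iff_vec_prod_zero[OF M] by blast
  define p where "p = (\<Sum>k\<le>n. monom (v $ k) k)"
  have cp: "coeff p k = (if k \<le> n then v $ k else 0)" for k
    unfolding p_def by (simp add: coeff_sum if_distrib cong: if_cong)
  have "p \<noteq> 0"
  proof
    assume "p = 0"
    hence "v $ k = 0" if "k \<le> n" for k using cp[of k] that by simp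
    hence "v = 0\<^sub>v (Suc n)" using v(1) by (intro eq_vecI) auto
    thus False using v by simp
  qed
  moreover have "(\<Sum>k\<le>degree p. coeff p k * ((T ^\<^sub>m k) *\<^sub>v w) $ i) = 0" if i: "i < n" for i
  proof -
    have dp: "degree p \<le> n" by (rule degree_le) (simp add: cp)
    have "(\<Sum>k\<le>degree p. coeff p k * ((T ^\<^sub>m k) *\<^sub>v w) $ i) = (\<Sum>k\<le>n. coeff p k * ((T ^\<^sub>m k) *\<^sub>v w) $ i)"
      using dp by (intro sum.mono_neutral_left) (auto simp: coeff_eq_0)
    also have "\<dots> = (\<Sum>k\<in>{0..<Suc n}. M $$ (i,k) * v $ k)"
      by (rule sum.cong) (use i in \<open>auto simp: M_def cp\<close>)
    also have "\<dots> = (M *\<^sub>v v) $ i"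
      using M v(1) i by (simp add: scalar_prod_def)
    also have "\<dots> = 0" using v(3) i by simp
    finally show ?thesis .
  qed
  ultimately show ?thesis using that by blast
qed

lemma eigenvector_in_invariant_set:
  fixes T :: "complex mat"
  assumes "T \<in> carrier_mat n n" "E \<subseteq> carrier_vec n"
    and "\<And>w c. w \<in> E \<Longrightarrow> T *\<^sub>v w - c \<cdot>\<^sub>v w \<in> E"
    and "w \<in> E" "w \<noteq> 0\<^sub>v n"
  obtains v c where "v \<in> E" "v \<noteq> 0\<^sub>v n" "T *\<^sub>v v = c \<cdot>\<^sub>v v"
proof -
  have "w \<in> carrier_vec n" using assms by auto
  from exists_annihilator[OF assms(1) this] obtain p where
    "p \<noteq> 0" "\<forall>i<n. (\<Sum>k\<le>degree p. coeff p k * ((T ^\<^sub>m k) *\<^sub>v w) $ i) = 0" by blast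
  from eigenvector_from_annihilator[OF assms(1-3) this(1) refl assms(4,5) this(2)]
  show ?thesis using that by blast
qed

text \<open>Supplies the closure hypothesis of \<open>eigenvector_in_invariant_set\<close> when the
  invariant set is an eigenspace of a commuting matrix.\<close>

lemma eigenspace_invariant:
  fixes T W :: "complex mat"
  assumes T: "T \<in> carrier_mat n n" and W: "W \<in> carrier_mat n n" and comm: "T * W = W * T"
    and w: "w \<in> carrier_vec n" "W *\<^sub>v w = a \<cdot>\<^sub>v w"
  shows "W *\<^sub>v (T *\<^sub>v w - c \<cdot>\<^sub>v w) = a \<cdot>\<^sub>v (T *\<^sub>v w - c \<cdot>\<^sub>v w)"
proof -
  have Tw: "T *\<^sub>v w \<in> carrier_vec n" using T w by auto
  have "W *\<^sub>v (T *\<^sub>v w - c \<cdot>\<^sub>v w) = W *\<^sub>v (T *\<^sub>v w) - W *\<^sub>v (c \<cdot>\<^sub>v w)"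
    by (rule mult_minus_distrib_mat_vec[OF W]) (use T w in auto)
  also have "W *\<^sub>v (T *\<^sub>v w) = T *\<^sub>v (W *\<^sub>v w)"
    using assoc_mult_mat_vec[OF W T w(1)] assoc_mult_mat_vec[OF T W w(1)] comm by simp
  also have "\<dots> = a \<cdot>\<^sub>v (T *\<^sub>v w)" unfolding w(2) by (rule mult_mat_vec[OF T w(1)])
  also have "W *\<^sub>v (c \<cdot>\<^sub>v w) = c \<cdot>\<^sub>v (a \<cdot>\<^sub>v w)" using mult_mat_vec[OF W w(1)] w(2) by simp
  also have "a \<cdot>\<^sub>v (T *\<^sub>v w) - c \<cdot>\<^sub>v (a \<cdot>\<^sub>v w) = a \<cdot>\<^sub>v (T *\<^sub>v w - c \<cdot>\<^sub>v w)"
  proof (rule eq_vecI)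
    fix i assume "i < dim_vec (a \<cdot>\<^sub>v (T *\<^sub>v w - c \<cdot>\<^sub>v w))"
    hence i: "i < dim_vec (T *\<^sub>v w)" "i < dim_vec w" using Tw w(1) T by auto
    show "(a \<cdot>\<^sub>v (T *\<^sub>v w) - c \<cdot>\<^sub>v (a \<cdot>\<^sub>v w)) $ i = (a \<cdot>\<^sub>v (T *\<^sub>v w - c \<cdot>\<^sub>v w)) $ i"
      using i by (simp del: index_mult_mat_vec add: algebra_simps)
  qed (use Tw w(1) in auto)
  finally show ?thesis .
qed

lemma pow_mat_commute:
  fixes T Y :: "complex mat"
  assumes T: "T \<in> carrier_mat n n" and Y: "Y \<in> carrier_mat n n" and comm: "T * Y = Y * T"
  shows "T * Y ^\<^sub>m s = Y ^\<^sub>m s * T"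
proof (induction s)
  case 0
  show ?case using T Y by simp
next
  case (Suc s)
  have Ys: "Y ^\<^sub>m s \<in> carrier_mat n n" using Y by simp
  have "T * Y ^\<^sub>m Suc s = (T * Y ^\<^sub>m s) * Y" using assoc_mult_mat[OF T Ys Y] by simp
  also have "\<dots> = Y ^\<^sub>m s * (T * Y)" unfolding Suc using assoc_mult_mat[OF Ys T Y] by simp
  also have "\<dots> = Y ^\<^sub>m Suc s * T" unfolding comm using assoc_mult_mat[OF Ys Y T] by simp
  finally show ?case .
qed

text \<open>\<open>T\<close>, \<open>Y\<close> and \<open>W = T * Y ^\<^sub>m s\<close> commute. The
  eigenspace \<open>E\<close> of \<open>W\<close> contains an eigenvector of \<open>T\<close>, and
  the part \<open>F\<close> of \<open>E\<close> in that eigenspace of \<open>T\<close> contains an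
  eigenvector of \<open>Y\<close>. On this common eigenvector the eigenvalues multiply.\<close>

lemma eigenvalue_commuting_product:
  fixes T Y :: "complex mat"
  assumes T: "T \<in> carrier_mat n n" and Y: "Y \<in> carrier_mat n n" and comm: "T * Y = Y * T"
    and ev: "eigenvalue (T * Y ^\<^sub>m s) \<theta>"
  obtains \<alpha> \<beta> where "eigenvalue T \<alpha>" "eigenvalue Y \<beta>" "\<theta> = \<alpha> * \<beta> ^ s"
proof -
  define W where "W = T * Y ^\<^sub>m s"
  have Ys: "Y ^\<^sub>m s \<in> carrier_mat n n" using Y by simp
  have W: "W \<in> carrier_mat n n" unfolding W_def using T Y by simp
  have YW: "Y * W = W * Y"
  proof -
    have "Y * W = (T * Y) * Y ^\<^sub>m s"
      unfolding W_def comm using assoc_mult_mat[OF Y T Ys] by simp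
    also have "\<dots> = T * (Y * Y ^\<^sub>m s)" using assoc_mult_mat[OF T Y Ys] by simp
    also have "\<dots> = T * (Y ^\<^sub>m s * Y)" using pow_mat_commute[OF Y Y refl] by simp
    also have "\<dots> = W * Y" unfolding W_def using assoc_mult_mat[OF T Ys Y] by simp
    finally show ?thesis .
  qed
  have TW: "T * W = W * T"
    unfolding W_def using assoc_mult_mat[OF T Ys T] pow_mat_commute[OF T Y comm] by simp
  obtain v where v: "v \<in> carrier_vec n" "v \<noteq> 0\<^sub>v n" "W *\<^sub>v v = \<theta> \<cdot>\<^sub>v v"
    using ev W unfolding eigenvalue_def eigenvector_def W_def[symmetric] by auto
  define E where "E = {w \<in> carrier_vec n. W *\<^sub>v w = \<theta> \<cdot>\<^sub>v w}"
  have "E \<subseteq> carrier_vec n" unfolding E_def by auto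
  moreover have "T *\<^sub>v w - c \<cdot>\<^sub>v w \<in> E" if "w \<in> E" for w c
    using eigenspace_invariant[OF T W TW] that T unfolding E_def by auto
  ultimately obtain w \<alpha> where w: "w \<in> E" "w \<noteq> 0\<^sub>v n" "T *\<^sub>v w = \<alpha> \<cdot>\<^sub>v w"
    using eigenvector_in_invariant_set[OF T, of E v] v unfolding E_def by blast
  define F where "F = {w \<in> E. T *\<^sub>v w = \<alpha> \<cdot>\<^sub>v w}"
  have "F \<subseteq> carrier_vec n" unfolding F_def E_def by auto
  moreover have "Y *\<^sub>v w - c \<cdot>\<^sub>v w \<in> F" if "w \<in> F" for w c
    using eigenspace_invariant[OF Y W YW] eigenspace_invariant[OF Y T comm[symmetric]] that Y
    unfolding F_def E_def by auto
  ultimately obtain z \<beta> where z: "z \<in> F" "z \<noteq> 0\<^sub>v n" "Y *\<^sub>v z = \<beta> \<cdot>\<^sub>v z"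
    using eigenvector_in_invariant_set[OF Y, of F w] w unfolding F_def by blast
  have zc: "z \<in> carrier_vec n" and Wz: "W *\<^sub>v z = \<theta> \<cdot>\<^sub>v z" and Tz: "T *\<^sub>v z = \<alpha> \<cdot>\<^sub>v z"
    using z(1) unfolding F_def E_def by auto
  have eT: "eigenvector T z \<alpha>" and eY: "eigenvector Y z \<beta>"
    using z zc Tz T Y unfolding eigenvector_def by auto
  have "W *\<^sub>v z = T *\<^sub>v (Y ^\<^sub>m s *\<^sub>v z)" unfolding W_def by (rule assoc_mult_mat_vec[OF T Ys zc])
  also have "\<dots> = T *\<^sub>v (\<beta> ^ s \<cdot>\<^sub>v z)" using eigenvector_pow[OF Y eY] by simp
  also have "\<dots> = \<beta> ^ s \<cdot>\<^sub>v (\<alpha> \<cdot>\<^sub>v z)" using mult_mat_vec[OF T zc] Tz by simp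
  finally have eq: "\<theta> \<cdot>\<^sub>v z = \<beta> ^ s \<cdot>\<^sub>v (\<alpha> \<cdot>\<^sub>v z)" using Wz by simp
  obtain i where i: "i < n" "z $ i \<noteq> 0"
    using z(2) zc by (metis carrier_vecD eq_vecI index_zero_vec(1,2))
  have "(\<theta> \<cdot>\<^sub>v z) $ i = (\<beta> ^ s \<cdot>\<^sub>v (\<alpha> \<cdot>\<^sub>v z)) $ i" using eq by simp
  hence "\<theta> = \<alpha> * \<beta> ^ s" using i zc by simp
  thus ?thesis using that eT eY unfolding eigenvalue_def by blast
qed

section \<open>The matrix exponential on eigenvectors\<close>

text \<open>A product entry is a sum of n terms, so the series of \<open>mexp\<close> is dominated
  entrywise by that of exp (n c).\<close>

lemma pow_mat_entry_bound:
  fixes M :: "complex mat"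
  assumes M: "M \<in> carrier_mat n n" and c: "\<And>i j. i < n \<Longrightarrow> j < n \<Longrightarrow> cmod (M $$ (i,j)) \<le> c" and c0: "0 \<le> c"
  shows "i < n \<Longrightarrow> j < n \<Longrightarrow> cmod ((M ^\<^sub>m k) $$ (i,j)) \<le> (real n * c) ^ k"
proof (induction k arbitrary: i j)
  case 0
  thus ?case using M by simp
next
  case (Suc k)
  have Mk: "M ^\<^sub>m k \<in> carrier_mat n n" using M by simp
  have "(M ^\<^sub>m Suc k) $$ (i,j) = (\<Sum>l\<in>{0..<n}. (M ^\<^sub>m k) $$ (i,l) * M $$ (l,j))"
    using Suc.prems M Mk by (simp add: scalar_prod_def)
  also have "cmod \<dots> \<le> (\<Sum>l\<in>{0..<n}. (real n * c) ^ k * c)"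
    by (rule sum_norm_le) (use Suc c c0 in \<open>auto simp: norm_mult intro!: mult_mono\<close>)
  also have "\<dots> = (real n * c) ^ Suc k" by simp
  finally show ?case .
qed

lemma summable_mexp_entry:
  fixes M :: "complex mat"
  assumes M: "M \<in> carrier_mat n n" and ij: "i < n" "j < n"
  shows "summable (\<lambda>k. (M ^\<^sub>m k) $$ (i,j) / of_nat (fact k))"
proof -
  define c where "c = (\<Sum>i<n. \<Sum>j<n. cmod (M $$ (i,j)))"
  have c: "cmod (M $$ (i,j)) \<le> c" if "i < n" "j < n" for i j
  proof -
    have "cmod (M $$ (i,j)) \<le> (\<Sum>j<n. cmod (M $$ (i,j)))"
      using that by (intro member_le_sum) auto
    also have "\<dots> \<le> c" unfolding c_def
      using that by (intro member_le_sum[of i "{..<n}" "\<lambda>i. \<Sum>j<n. cmod (M $$ (i,j))"]) (auto intro: sum_nonneg)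
    finally show ?thesis .
  qed
  have c0: "0 \<le> c" unfolding c_def by (intro sum_nonneg) auto
  show ?thesis
  proof (rule summable_comparison_test')
    show "summable (\<lambda>k. (real n * c) ^ k / fact k)"
      using summable_exp[of "real n * c"] by (simp add: field_simps)
    show "norm ((M ^\<^sub>m k) $$ (i,j) / of_nat (fact k)) \<le> (real n * c) ^ k / fact k" for k
      using pow_mat_entry_bound[OF M c c0 ij, of k] by (simp add: norm_divide divide_right_mono)
  qed
qed

text \<open>An eigenvector of \<open>M\<close> is one of every power, so on it the matrix series
  becomes the scalar exponential series. Entrywise summability allows the sum over columns to be
  exchanged with the series.\<close>

lemma eigenvalue_mexp:
  fixes M :: "complex mat"
  assumes M: "M \<in> carrier_mat n n" and ev: "eigenvalue M \<theta>"
  shows "eigenvalue (mexp M) (exp \<theta>)"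
proof -
  obtain v where v: "eigenvector M v \<theta>" using ev unfolding eigenvalue_def by auto
  have vc: "v \<in> carrier_vec n" "v \<noteq> 0\<^sub>v n" using v M unfolding eigenvector_def by auto
  have mc: "mexp M \<in> carrier_mat n n" using M unfolding mexp_def by auto
  have "mexp M *\<^sub>v v = exp \<theta> \<cdot>\<^sub>v v"
  proof (rule eq_vecI)
    fix i assume "i < dim_vec (exp \<theta> \<cdot>\<^sub>v v)"
    hence i: "i < n" using vc by simp
    have "(mexp M *\<^sub>v v) $ i = (\<Sum>j\<in>{0..<n}. (\<Sum>k. (M ^\<^sub>m k) $$ (i,j) / of_nat (fact k)) * v $ j)"
      using i vc mc M by (simp add: scalar_prod_def mexp_def)
    also have "\<dots> = (\<Sum>j\<in>{0..<n}. \<Sum>k. (M ^\<^sub>m k) $$ (i,j) / of_nat (fact k) * v $ j)"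
      by (intro sum.cong refl suminf_mult2 summable_mexp_entry[OF M i]) auto
    also have "\<dots> = (\<Sum>k. \<Sum>j\<in>{0..<n}. (M ^\<^sub>m k) $$ (i,j) / of_nat (fact k) * v $ j)"
      by (rule suminf_sum[symmetric]) (rule summable_mult2, rule summable_mexp_entry[OF M i], simp)
    also have "\<dots> = (\<Sum>k. (\<theta> ^ k /\<^sub>R fact k) * v $ i)"
    proof (rule suminf_cong)
      fix k
      have Mk: "M ^\<^sub>m k \<in> carrier_mat n n" using M by simp
      have "(\<Sum>j\<in>{0..<n}. (M ^\<^sub>m k) $$ (i,j) / of_nat (fact k) * v $ j)
        = (\<Sum>j\<in>{0..<n}. (M ^\<^sub>m k) $$ (i,j) * v $ j) / of_nat (fact k)"
        by (simp add: sum_divide_distrib)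
      also have "(\<Sum>j\<in>{0..<n}. (M ^\<^sub>m k) $$ (i,j) * v $ j) = ((M ^\<^sub>m k) *\<^sub>v v) $ i"
        using i vc M carrier_matD[OF Mk] by (simp add: scalar_prod_def)
      also have "\<dots> = \<theta> ^ k * v $ i" using eigenvector_pow[OF M v] i vc by simp
      finally show "(\<Sum>j\<in>{0..<n}. (M ^\<^sub>m k) $$ (i,j) / of_nat (fact k) * v $ j) = (\<theta> ^ k /\<^sub>R fact k) * v $ i"
        by (simp add: scaleR_conv_of_real field_simps)
    qed
    also have "\<dots> = exp \<theta> * v $ i"
      unfolding exp_def by (rule suminf_mult2[symmetric]) (rule summable_exp_generic)
    finally show "(mexp M *\<^sub>v v) $ i = (exp \<theta> \<cdot>\<^sub>v v) $ i" using i vc by simp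
  qed (use vc mc in auto)
  thus ?thesis using vc mc unfolding eigenvalue_def eigenvector_def by auto
qed

section \<open>Root branches of monic bivariate polynomials\<close>

text \<open>The outer variable of \<open>F\<close> is the eigenvalue x and the inner one the pencil
  parameter u. With this order a characteristic polynomial is monic in the outer variable, so its
  degree is the same in all fibres.\<close>

definition fibre :: "complex \<Rightarrow> complex poly poly \<Rightarrow> complex poly" where
  "fibre u F = map_poly (\<lambda>p. poly p u) F"

definition poly2 :: "complex poly poly \<Rightarrow> complex \<Rightarrow> complex \<Rightarrow> complex" where
  "poly2 F x u = poly (fibre u F) x"

lemma fibre_pderiv: "fibre u (pderiv F) = pderiv (fibre u F)"
  unfolding fibre_def by (rule poly_hom.map_poly_pderiv)

lemma fibre_pderiv_funpow: "fibre u ((pderiv ^^ k) F) = (pderiv ^^ k) (fibre u F)"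
  by (induction k) (auto simp: fibre_pderiv)

lemma fibre_mult: "fibre u (F * G) = fibre u F * fibre u G"
proof -
  interpret h: map_poly_comm_ring_hom "\<lambda>p :: complex poly. poly p u" ..
  show ?thesis unfolding fibre_def by (rule h.hom_mult)
qed

lemma fibre_monic:
  assumes "lead_coeff Q = 1"
  shows "degree (fibre u Q) = degree Q" "lead_coeff (fibre u Q) = 1" "fibre u Q \<noteq> 0"
proof -
  show d: "degree (fibre u Q) = degree Q"
    unfolding fibre_def by (rule map_poly_degree_eq) (simp add: assms)
  show l: "lead_coeff (fibre u Q) = 1" unfolding d unfolding fibre_def by (simp add: coeff_map_poly assms)
  show "fibre u Q \<noteq> 0" using l by auto
qed

lemma poly2_0 [simp]: "poly2 0 x u = 0"
  by (simp add: poly2_def fibre_def)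

lemma poly2_pCons [simp]: "poly2 (pCons a F) x u = poly a u + x * poly2 F x u"
  by (simp add: poly2_def fibre_def poly_hom.map_poly_pCons_hom)

lemma poly2_eq_poly_poly: "poly2 F x u = poly (poly F [:x:]) u"
  by (induction F) auto

text \<open>Turns vanishing along a polynomial curve x = c(u) into a statement about
  \<open>poly F c\<close>, that is, about \<open>c\<close> as a root of \<open>F\<close> over the
  polynomial ring.\<close>

lemma poly2_linear: "poly2 F (poly c u) u = poly (poly F c) u"
  by (induction F) auto

lemma poly2_mult: "poly2 (F * G) x u = poly2 F x u * poly2 G x u"
  by (simp add: poly2_def fibre_mult)

lemma poly2_add: "poly2 (F + G) x u = poly2 F x u + poly2 G x u"
  by (simp add: poly2_eq_poly_poly)

lemma continuous_on_poly2 [continuous_intros]: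
  assumes "continuous_on S f" "continuous_on S g"
  shows "continuous_on S (\<lambda>z. poly2 F (f z) (g z))"
  using assms by (induction F) (auto intro!: continuous_intros)

section \<open>Continuous difference quotients of polynomials\<close>

lemma poly_difference_quotient:
  fixes p :: "complex poly"
  shows "\<exists>e. continuous_on UNIV e \<and> (\<forall>u u'. poly p u' - poly p u = (u' - u) * e (u, u'))"
proof (induction p)
  case 0
  show ?case by (intro exI[of _ "\<lambda>_. 0"]) simp
next
  case (pCons a p)
  then obtain e where e: "continuous_on UNIV e" "\<And>u u'. poly p u' - poly p u = (u' - u) * e (u, u')" by blast
  have "poly (pCons a p) u' - poly (pCons a p) u = (u' - u) * (poly p u' + u * e (u, u'))" for u u'
  proof -
    have "poly (pCons a p) u' - poly (pCons a p) u = (u' - u) * poly p u' + u * (poly p u' - poly p u)"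
      by (simp add: algebra_simps)
    thus ?thesis unfolding e(2) by (simp add: algebra_simps)
  qed
  moreover have "continuous_on UNIV (\<lambda>z. poly p (snd z) + fst z * e (fst z, snd z))"
    using e(1) by (auto intro!: continuous_intros)
  ultimately show ?case
    by (intro exI[of _ "\<lambda>z. poly p (snd z) + fst z * e (fst z, snd z)"]) auto
qed

text \<open>The quotient is built by Horner recursion, without division, and is therefore continuous
  across the diagonal, where it is the partial derivative in x.\<close>

lemma poly2_difference_quotient_fst:
  "\<exists>D. continuous_on UNIV D \<and> (\<forall>x x' u. poly2 F x' u - poly2 F x u = (x' - x) * D (x, x', u))
     \<and> (\<forall>x u. D (x, x, u) = poly2 (pderiv F) x u)"
proof (induction F)
  case 0
  show ?case by (intro exI[of _ "\<lambda>_. 0"]) simp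
next
  case (pCons a F)
  then obtain D where D: "continuous_on UNIV D"
    "\<And>x x' u. poly2 F x' u - poly2 F x u = (x' - x) * D (x, x', u)"
    "\<And>x u. D (x, x, u) = poly2 (pderiv F) x u" by blast
  define D' where "D' = (\<lambda>z. poly2 F (fst (snd z)) (snd (snd z)) + fst z * D (fst z, fst (snd z), snd (snd z)))"
  have "poly2 (pCons a F) x' u - poly2 (pCons a F) x u = (x' - x) * D' (x, x', u)" for x x' u
  proof -
    have "poly2 (pCons a F) x' u - poly2 (pCons a F) x u
        = (x' - x) * poly2 F x' u + x * (poly2 F x' u - poly2 F x u)"
      by (simp add: algebra_simps)
    thus ?thesis unfolding D(2) D'_def by (simp add: algebra_simps)
  qed
  moreover have "continuous_on UNIV D'" unfolding D'_def
    using D(1) by (auto intro!: continuous_intros)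
  moreover have "D' (x, x, u) = poly2 (pderiv (pCons a F)) x u" for x u
    by (simp add: D'_def D(3) pderiv_pCons poly2_add)
  ultimately show ?case by blast
qed

lemma poly2_difference_quotient_snd:
  "\<exists>E. continuous_on UNIV E \<and> (\<forall>x u u'. poly2 F x u' - poly2 F x u = (u' - u) * E (x, u, u'))"
proof (induction F)
  case 0
  show ?case by (intro exI[of _ "\<lambda>_. 0"]) simp
next
  case (pCons a F)
  then obtain E where E: "continuous_on UNIV E"
    "\<And>x u u'. poly2 F x u' - poly2 F x u = (u' - u) * E (x, u, u')" by blast
  obtain e where e: "continuous_on UNIV e" "\<And>u u'. poly a u' - poly a u = (u' - u) * e (u, u')"
    using poly_difference_quotient[of a] by blast
  define E' where "E' = (\<lambda>z. e (snd z) + fst z * E z)"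
  have "poly2 (pCons a F) x u' - poly2 (pCons a F) x u = (u' - u) * E' (x, u, u')" for x u u'
  proof -
    have "poly2 (pCons a F) x u' - poly2 (pCons a F) x u
        = (poly a u' - poly a u) + x * (poly2 F x u' - poly2 F x u)"
      by (simp add: algebra_simps)
    thus ?thesis unfolding E(2) e(2) E'_def by (simp add: algebra_simps)
  qed
  moreover have "continuous_on UNIV E'" unfolding E'_def
    using E(1) e(1) by (auto intro!: continuous_intros intro: continuous_on_compose2[OF e(1)])
  ultimately show ?case by blast
qed

section \<open>Multiplicities of roots and existence of branches\<close>

lemma order_pderiv_funpow:
  fixes p :: "complex poly"
  assumes "p \<noteq> 0" "k \<le> order x p"
  shows "(pderiv ^^ k) p \<noteq> 0 \<and> order x ((pderiv ^^ k) p) = order x p - k"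
  using assms(2)
proof (induction k)
  case (Suc k)
  hence IH: "(pderiv ^^ k) p \<noteq> 0" "order x ((pderiv ^^ k) p) = order x p - k" by auto
  have "order x ((pderiv ^^ k) p) \<noteq> 0" using IH Suc.prems by simp
  hence root: "poly ((pderiv ^^ k) p) x = 0" using order_root by blast
  have "order x ((pderiv ^^ k) p) = Suc (order x (pderiv ((pderiv ^^ k) p)))"
    by (rule order_pderiv[OF IH(1) root])
  \<comment> \<open>A vanishing derivative would make the polynomial constant, and a constant with a
    root is zero.\<close>
  moreover have "pderiv ((pderiv ^^ k) p) \<noteq> 0"
  proof
    assume "pderiv ((pderiv ^^ k) p) = 0"
    then obtain c where c: "(pderiv ^^ k) p = [:c:]" by (metis pderiv_iszero)
    show False using root IH(1) unfolding c by simp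
  qed
  ultimately show ?case using IH(2) by simp
qed (use assms(1) in auto)

text \<open>If all roots were at distance at least \<delta> from x, then the product of the |x -
  r_i|, which is |p(x)|, would be at least \<delta>^deg p.\<close>

lemma monic_root_near:
  fixes p :: "complex poly"
  assumes "lead_coeff p = 1" "0 < \<delta>" "cmod (poly p x) < \<delta> ^ degree p"
  shows "\<exists>z. poly p z = 0 \<and> dist z x < \<delta>"
proof (rule ccontr)
  assume "\<not> ?thesis"
  hence far: "\<delta> \<le> dist z x" if "poly p z = 0" for z using that by force
  obtain r where r: "p = (\<Prod>i<degree p. [:- r i, 1:])"
    using complex_poly_decompose'[of p] assms(1) by (metis smult_1_left)
  have root: "poly p (r i) = 0" if "i < degree p" for i
  proof -
    have "poly (\<Prod>i<degree p. [:- r i, 1:]) (r i) = 0"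
      unfolding poly_prod by (rule prod_zero) (use that in auto)
    thus ?thesis using r by simp
  qed
  have "\<delta> ^ degree p = (\<Prod>i<degree p. \<delta>)" by simp
  also have "\<dots> \<le> (\<Prod>i<degree p. cmod (x - r i))"
    using far[OF root] assms(2) by (intro prod_mono) (auto simp: dist_norm norm_minus_commute)
  also have "\<dots> = cmod (poly (\<Prod>i<degree p. [:- r i, 1:]) x)"
    unfolding poly_prod prod_norm[symmetric] by simp
  also have "\<dots> = cmod (poly p x)" using r by simp
  finally show False using assms(3) by simp
qed

text \<open>The function \<open>G\<close> is a difference quotient of \<open>y\<close> that is jointly continuous up to the
  diagonal, where it is the derivative.\<close>

definition root_branch ::
  "complex poly poly \<Rightarrow> real set \<Rightarrow> (real \<Rightarrow> complex) \<Rightarrow> (real \<times> real \<Rightarrow> complex) \<Rightarrow> bool" where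
  "root_branch Q I y G \<longleftrightarrow>
     (\<forall>u\<in>I. poly2 Q (y u) (of_real u) = 0) \<and> continuous_on (I \<times> I) G \<and>
     (\<forall>u\<in>I. \<forall>u'\<in>I. y u' - y u = of_real (u' - u) * G (u, u'))"

text \<open>At a root of minimal multiplicity \<open>m\<close>, the roots of \<open>Q\<close> nearby are simple roots
  of the \<open>(m - 1)\<close>-st derivative.\<close>

lemma exists_root_branch:
  assumes monic: "lead_coeff Q = 1" and deg: "0 < degree Q"
  obtains a b y G where "0 < a" "a < b" "root_branch Q {a<..<b} y G"
proof -
  \<comment> \<open>Multiplicities are compared over positive parameters only, since the interval of
    the branch has to lie there.\<close>
  define P where "P = (\<lambda>m. \<exists>(u::real)>0. \<exists>x. poly2 Q x (of_real u) = 0 \<and> order x (fibre (of_real u) Q) = m)"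
  have "\<exists>m. P m"
  proof -
    have "\<not> constant (poly (fibre 1 Q))"
      using deg fibre_monic(1)[OF monic, of 1] by (simp add: constant_degree)
    then obtain x where "poly (fibre 1 Q) x = 0" using fundamental_theorem_of_algebra by blast
    hence "P (order x (fibre 1 Q))" unfolding P_def poly2_def by (intro exI[of _ "1::real"]) auto
    thus ?thesis by blast
  qed
  define m where "m = (LEAST m. P m)"
  have "P m" unfolding m_def by (rule LeastI_ex) fact
  then obtain u0 :: real and x0 where u0: "u0 > 0" "poly2 Q x0 u0 = 0" "order x0 (fibre u0 Q) = m"
    unfolding P_def by blast
  have m1: "m \<noteq> 0" using u0 fibre_monic(3)[OF monic, of u0] unfolding poly2_def by (metis order_root)
  have m_le: "m \<le> order x (fibre (of_real u) Q)" if "u > 0" "poly2 Q x (of_real u) = 0" for x and u :: real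
    unfolding m_def by (rule Least_le) (use that in \<open>auto simp: P_def\<close>)
  \<comment> \<open>Every root of \<open>Q\<close> at a positive parameter has multiplicity at least
    m, so it is still a root of \<open>F\<close>; at (x0, u0) the multiplicity is exactly m, so
    there \<open>F\<close> has a simple root.\<close>
  define F where "F = (pderiv ^^ (m - 1)) Q"
  have F0: "poly2 F x (of_real u) = 0" if "u > 0" "poly2 Q x (of_real u) = 0" for x and u :: real
  proof -
    have "order x ((pderiv ^^ (m-1)) (fibre u Q)) = order x (fibre u Q) - (m - 1)"
      using order_pderiv_funpow[OF fibre_monic(3)[OF monic]] m_le[OF that] by simp
    hence "order x (fibre u F) \<noteq> 0" unfolding F_def fibre_pderiv_funpow using m_le[OF that] m1 by simp
    thus ?thesis unfolding poly2_def using order_root by blast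
  qed
  have F1: "poly2 (pderiv F) x0 u0 \<noteq> 0"
  proof -
    have "(pderiv ^^ m) (fibre u0 Q) \<noteq> 0 \<and> order x0 ((pderiv ^^ m) (fibre u0 Q)) = 0"
      using order_pderiv_funpow[OF fibre_monic(3)[OF monic], of m x0 u0] u0 by simp
    moreover have "fibre u0 (pderiv F) = (pderiv ^^ m) (fibre u0 Q)"
      unfolding F_def fibre_pderiv fibre_pderiv_funpow using m1
      by (metis Suc_pred comp_apply funpow.simps(2) neq0_conv One_nat_def)
    ultimately show ?thesis unfolding poly2_def by (simp add: order_root)
  qed
  obtain D where D: "continuous_on UNIV D"
    "\<And>x x' u. poly2 F x' u - poly2 F x u = (x' - x) * D (x, x', u)"
    "\<And>x u. D (x, x, u) = poly2 (pderiv F) x u"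
    using poly2_difference_quotient_fst[of F] by blast
  obtain E where E: "continuous_on UNIV E"
    "\<And>x u u'. poly2 F x u' - poly2 F x u = (u' - u) * E (x, u, u')"
    using poly2_difference_quotient_snd[of F] by blast
  define c where "c = cmod (D (x0, x0, u0)) / 2"
  have c: "c > 0" unfolding c_def using F1 D(3) by simp
  have "\<exists>\<delta>>0. \<forall>z. dist z (x0, x0, of_real u0) < \<delta> \<longrightarrow> dist (D z) (D (x0, x0, of_real u0)) < c"
    using D(1) c unfolding continuous_on_iff by blast
  then obtain \<delta>1 where \<delta>1: "\<delta>1 > 0"
    "\<And>z. dist z (x0, x0, of_real u0) < \<delta>1 \<Longrightarrow> dist (D z) (D (x0, x0, of_real u0)) < c" by blast
  \<comment> \<open>The distance between triples is at most the sum of the three coordinate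
    distances.\<close>
  define \<delta> where "\<delta> = \<delta>1 / 3"
  have \<delta>: "\<delta> > 0" unfolding \<delta>_def using \<delta>1 by simp
  have Dc: "c \<le> cmod (D (x, x', of_real u))" if "dist x x0 < \<delta>" "dist x' x0 < \<delta>" "\<bar>u - u0\<bar> < \<delta>"
    for x x' and u :: real
  proof -
    have "dist (of_real u :: complex) (of_real u0) < \<delta>"
      using that(3) by (simp add: dist_of_real dist_real_def)
    moreover have "dist (x, x', of_real u :: complex) (x0, x0, of_real u0)
       \<le> dist x x0 + (dist x' x0 + dist (of_real u :: complex) (of_real u0))"
      unfolding dist_Pair_Pair[of x]
      by (rule order_trans[OF sqrt_sum_squares_le_sum])
         (auto simp: dist_Pair_Pair intro!: sqrt_sum_squares_le_sum)
    ultimately have "dist (x, x', of_real u :: complex) (x0, x0, of_real u0) < \<delta>1"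
      using that unfolding \<delta>_def by simp
    from \<delta>1(2)[OF this] have "cmod (D (x0, x0, of_real u0) - D (x, x', of_real u)) < c"
      by (simp add: dist_norm norm_minus_commute)
    moreover have "cmod (D (x0, x0, of_real u0)) \<le> cmod (D (x0, x0, of_real u0) - D (x, x', of_real u)) + cmod (D (x, x', of_real u))"
      by (metis diff_add_cancel norm_triangle_ineq)
    ultimately show ?thesis unfolding c_def by simp
  qed
  \<comment> \<open>As Q(x0, u0) = 0, the value Q(x0, u) is small for u near u0, and
    \<open>monic_root_near\<close> then yields a root within \<delta> of x0.\<close>
  have "continuous_on UNIV (\<lambda>u::real. poly2 Q x0 (of_real u))" by (intro continuous_intros)
  then obtain \<eta> where \<eta>: "\<eta> > 0"
    "\<And>u::real. dist u u0 < \<eta> \<Longrightarrow> dist (poly2 Q x0 (of_real u)) (poly2 Q x0 (of_real u0)) < \<delta> ^ degree Q"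
    using \<delta> unfolding continuous_on_iff by (metis UNIV_I zero_less_power)
  define \<epsilon> where "\<epsilon> = min (u0 / 2) (min \<delta> \<eta>)"
  have \<epsilon>: "\<epsilon> > 0" "\<epsilon> < u0" "\<epsilon> \<le> \<delta>" "\<epsilon> \<le> \<eta>" unfolding \<epsilon>_def using u0 \<delta> \<eta> by auto
  define I where "I = {u0 - \<epsilon> <..< u0 + \<epsilon>}"
  have Ipos: "u > 0" and Iu: "\<bar>u - u0\<bar> < \<epsilon>" if "u \<in> I" for u using that \<epsilon> unfolding I_def by auto
  have "\<exists>x. poly2 Q x (of_real u) = 0 \<and> dist x x0 < \<delta>" if "u \<in> I" for u
  proof -
    have "cmod (poly2 Q x0 (of_real u)) < \<delta> ^ degree Q"
      using \<eta>(2)[of u] Iu[OF that] \<epsilon> u0 by (simp add: dist_real_def)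
    thus ?thesis unfolding poly2_def
      using monic_root_near[OF fibre_monic(2)[OF monic] \<delta>] fibre_monic(1)[OF monic] by metis
  qed
  \<comment> \<open>The roots are picked independently for each u. Continuity of the selection is
    forced afterwards by the identity \<open>yG\<close>.\<close>
  then obtain y where y: "\<And>u. u \<in> I \<Longrightarrow> poly2 Q (y u) (of_real u) = 0" "\<And>u. u \<in> I \<Longrightarrow> dist (y u) x0 < \<delta>"
    by metis
  \<comment> \<open>\<open>F\<close> vanishes at (y(u), u) and (y(u'), u'). Passing through (y(u),
    u') splits the zero difference into (y(u') - y(u)) D + (u' - u) E = 0, which is solved for the
    quotient.\<close>
  define G where "G = (\<lambda>(u,u'). - E (y u, of_real u, of_real u') / D (y u, y u', of_real u'))"
  have Dn: "c \<le> cmod (D (y u, y u', of_real u'))" if "u \<in> I" "u' \<in> I" for u u'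
    using Dc[OF y(2)[OF that(1)] y(2)[OF that(2)]] Iu[OF that(2)] \<epsilon> by simp
  have yG: "y u' - y u = of_real (u' - u) * G (u, u')" if "u \<in> I" "u' \<in> I" for u u'
  proof -
    have "poly2 F (y u') (of_real u') = 0" "poly2 F (y u) (of_real u) = 0"
      using F0 y(1) Ipos that by auto
    hence "(poly2 F (y u') (of_real u') - poly2 F (y u) (of_real u')) +
      (poly2 F (y u) (of_real u') - poly2 F (y u) (of_real u)) = 0" by simp
    hence "(y u' - y u) * D (y u, y u', of_real u') = - ((of_real u' - of_real u) * E (y u, of_real u, of_real u'))"
      unfolding D(2) E(2) by (simp add: add_eq_0_iff2)
    moreover have "D (y u, y u', of_real u') \<noteq> 0" using Dn[OF that] c by auto
    ultimately show ?thesis unfolding G_def by (simp add: field_simps)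
  qed
  \<comment> \<open>\<open>E\<close> is bounded by some B on a compact set and |D| is at least c, so
    |G| is at most B/c and y is Lipschitz.\<close>
  have conty: "continuous_on I y"
  proof -
    define K where "K = cball x0 \<delta> \<times> (of_real ` {u0 - \<epsilon>..u0 + \<epsilon>} :: complex set) \<times> (of_real ` {u0 - \<epsilon>..u0 + \<epsilon>} :: complex set)"
    have cR: "compact (of_real ` {u0 - \<epsilon>..u0 + \<epsilon>} :: complex set)"
      by (intro compact_continuous_image continuous_intros) auto
    have "compact K" unfolding K_def by (intro compact_Times cR) auto
    hence "bounded (E ` K)"
      using compact_continuous_image[of K E] continuous_on_subset[OF E(1)] by (auto intro: compact_imp_bounded)
    then obtain B where B: "B > 0" "\<And>z. z \<in> K \<Longrightarrow> cmod (E z) \<le> B"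
      unfolding bounded_pos by auto
    have lip: "dist (y u') (y u) \<le> B / c * dist u' u" if "u \<in> I" "u' \<in> I" for u u'
    proof -
      have "(y u, of_real u, of_real u') \<in> K"
        using y(2)[OF that(1)] that unfolding K_def I_def by (auto simp: dist_commute intro: less_imp_le)
      hence "cmod (G (u,u')) \<le> B / c" unfolding G_def
        using B Dn[OF that] c by (simp add: norm_divide frac_le)
      hence "\<bar>u' - u\<bar> * cmod (G (u,u')) \<le> \<bar>u' - u\<bar> * (B / c)" by (intro mult_left_mono) auto
      thus ?thesis using yG[OF that] by (simp add: dist_norm norm_mult mult.commute del: of_real_diff)
    qed
    show ?thesis unfolding continuous_on_iff
    proof (intro ballI allI impI)
      fix u e :: real assume u: "u \<in> I" and e: "e > 0"
      show "\<exists>d>0. \<forall>u'\<in>I. dist u' u < d \<longrightarrow> dist (y u') (y u) < e"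
      proof (intro exI[of _ "e * c / B"] conjI ballI impI)
        show "e * c / B > 0" using e c B by simp
        fix u' assume u': "u' \<in> I" "dist u' u < e * c / B"
        have "B / c * dist u' u < B / c * (e * c / B)" using u'(2) B c by (intro mult_strict_left_mono) auto
        hence "B / c * dist u' u < e" using B c by simp
        thus "dist (y u') (y u) < e" using lip[OF u u'(1)] by simp
      qed
    qed
  qed
  have "continuous_on (I \<times> I) G"
  proof -
    have y1: "continuous_on (I \<times> I) (\<lambda>z. y (fst z))" "continuous_on (I \<times> I) (\<lambda>z. y (snd z))"
      by (auto intro!: continuous_on_compose2[OF conty] continuous_intros)
    have "continuous_on (I \<times> I) (\<lambda>z. - E (y (fst z), of_real (fst z), of_real (snd z))
        / D (y (fst z), y (snd z), of_real (snd z)))"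
    proof (intro continuous_on_divide continuous_on_minus ballI)
      show "continuous_on (I \<times> I) (\<lambda>z. E (y (fst z), of_real (fst z), of_real (snd z)))"
        by (rule continuous_on_compose2[OF E(1)]) (auto intro!: continuous_intros y1)
      show "continuous_on (I \<times> I) (\<lambda>z. D (y (fst z), y (snd z), of_real (snd z)))"
        by (rule continuous_on_compose2[OF D(1)]) (auto intro!: continuous_intros y1)
      fix z assume "z \<in> I \<times> I"
      thus "D (y (fst z), y (snd z), of_real (snd z)) \<noteq> 0" using Dn[of "fst z" "snd z"] c by auto
    qed
    thus ?thesis unfolding G_def by (simp add: case_prod_beta)
  qed
  hence "root_branch Q I y G" unfolding root_branch_def using y(1) yG by blast
  thus ?thesis using that[of "u0 - \<epsilon>" "u0 + \<epsilon>"] \<epsilon> unfolding I_def by auto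
qed

section \<open>From slopes of branches to linear factors\<close>

lemma root_branch_derivative:
  assumes br: "root_branch Q I y G" and u: "u \<in> I"
  shows "(y has_vector_derivative G (u, u)) (at u within I)"
proof -
  have y: "y z - y u = of_real (z - u) * G (u, z)" if "z \<in> I" for z
    using br u that unfolding root_branch_def by blast
  have "continuous_on (I \<times> I) G" using br unfolding root_branch_def by blast
  hence "continuous_on I (\<lambda>z. G (u, z))"
    by (rule continuous_on_compose2) (use u in \<open>auto intro!: continuous_intros\<close>)
  hence lim: "((\<lambda>z. G (u, z)) \<longlongrightarrow> G (u, u)) (at u within I)"
    using u unfolding continuous_on_def by blast
  \<comment> \<open>The quotient of y at u is G(u, z), which tends to G(u, u). Real and imaginary
    parts are separated because the vector derivative is reduced to two real derivatives.\<close>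
  have q: "Re (y z) - Re (y u) = (z - u) * Re (G (u, z))" "Im (y z) - Im (y u) = (z - u) * Im (G (u, z))"
    if "z \<in> I" for z
    using arg_cong[OF y[OF that], of Re] arg_cong[OF y[OF that], of Im] by (auto simp del: of_real_diff)
  have ev: "\<forall>\<^sub>F z in at u within I. z \<in> I \<and> z \<noteq> u" by (auto simp: eventually_at_filter)
  have "((\<lambda>z. (Re (y z) - Re (y u)) / (z - u)) \<longlongrightarrow> Re (G (u, u))) (at u within I)"
    by (rule Lim_transform_eventually[OF tendsto_Re[OF lim]])
       (use ev in eventually_elim, simp add: q)
  moreover have "((\<lambda>z. (Im (y z) - Im (y u)) / (z - u)) \<longlongrightarrow> Im (G (u, u))) (at u within I)"
    by (rule Lim_transform_eventually[OF tendsto_Im[OF lim]])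
       (use ev in eventually_elim, simp add: q)
  ultimately show ?thesis
    unfolding has_vector_derivative_complex_iff has_field_derivative_iff by blast
qed

lemma root_branch_affine:
  assumes br: "root_branch Q {a<..<b} y G" and d: "\<And>u. u \<in> {a<..<b} \<Longrightarrow> G (u, u) = d"
  obtains c where "\<And>u. u \<in> {a<..<b} \<Longrightarrow> y u = c + of_real u * d"
proof -
  have "((\<lambda>u. y u - of_real u * d) has_vector_derivative 0) (at u within {a<..<b})" if "u \<in> {a<..<b}" for u
  proof -
    have "((\<lambda>u. y u - of_real u * d) has_vector_derivative (G (u, u) - of_real 1 * d)) (at u within {a<..<b})"
      by (intro derivative_intros root_branch_derivative[OF br that])
    thus ?thesis using d[OF that] by simp
  qed
  then obtain c where "\<And>u. u \<in> {a<..<b} \<Longrightarrow> y u - of_real u * d = c"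
    using has_vector_derivative_zero_constant[of "{a<..<b}" "\<lambda>u. y u - of_real u * d"] by auto
  hence "y u = c + of_real u * d" if "u \<in> {a<..<b}" for u using that by (metis diff_add_cancel)
  thus ?thesis using that by blast
qed

text \<open>The slope is continuous on an interval, so its set of values is connected; being
  countable, it is a single point d. The branch is then c + u d, and Q(c + u d, u) is a polynomial
  in u with infinitely many zeros, so X - (c + u d) divides Q.\<close>

lemma linear_factor_exists:
  assumes monic: "lead_coeff Q = 1" and deg: "0 < degree Q"
    and Z: "countable Z"
    and slopes: "\<And>a b y G u. \<lbrakk>0 < a; root_branch Q {a<..<b} y G; u \<in> {a<..<b}\<rbrakk> \<Longrightarrow> G (u, u) \<in> Z"
  obtains c d where "[:- [:c, d:], 1:] dvd Q"
proof -
  obtain a b y G where ab: "0 < a" "a < b" and br: "root_branch Q {a<..<b} y G"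
    using exists_root_branch[OF monic deg] by blast
  define I where "I = {a<..<b}"
  define g where "g = (\<lambda>u. G (u, u))"
  have "continuous_on (I \<times> I) G" using br unfolding root_branch_def I_def by blast
  hence "continuous_on I g" unfolding g_def
    by (rule continuous_on_compose2) (auto intro!: continuous_intros)
  hence conn: "connected (g ` I)" by (rule connected_continuous_image) (simp add: I_def)
  have "g ` I \<subseteq> Z" unfolding g_def I_def using slopes[OF ab(1) br] by auto
  hence "countable (g ` I)" using Z countable_subset by blast
  hence const: "g u = g v" if "u \<in> I" "v \<in> I" for u v
    using connected_uncountable[OF conn] that by blast
  define d where "d = g ((a + b) / 2)"
  have "G (u, u) = d" if "u \<in> {a<..<b}" for u
    using const[of u "(a+b)/2"] that ab unfolding d_def g_def I_def by auto
  from root_branch_affine[OF br this] obtain c where c: "\<And>u. u \<in> {a<..<b} \<Longrightarrow> y u = c + of_real u * d"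
    by blast
  have zero: "poly (poly Q [:c, d:]) (of_real u) = 0" if "u \<in> {a<..<b}" for u
  proof -
    have "poly2 Q (y u) (of_real u) = 0" using br that unfolding root_branch_def by blast
    moreover have "y u = poly [:c, d:] (of_real u)" using c[OF that] by simp
    ultimately show ?thesis using poly2_linear by metis
  qed
  have "infinite {a<..<b}" using ab by simp
  hence "infinite ((of_real :: real \<Rightarrow> complex) ` {a<..<b})"
    by (subst finite_image_iff) (auto intro: inj_onI)
  moreover have "of_real ` {a<..<b} \<subseteq> {z. poly (poly Q [:c, d:]) z = 0}" using zero by auto
  ultimately have "poly Q [:c, d:] = 0" using poly_roots_finite finite_subset by blast
  thus ?thesis using that poly_eq_0_iff_dvd by blast
qed

text \<open>Induction by splitting off one linear factor. A branch of the cofactor is also a branch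
  of \<open>Q\<close>, so the hypothesis on slopes is inherited.\<close>

lemma bivariate_linear_factors:
  assumes "lead_coeff Q = 1" "degree Q = n" and Z: "countable Z"
    and "\<And>a b y G u. \<lbrakk>0 < a; root_branch Q {a<..<b} y G; u \<in> {a<..<b}\<rbrakk> \<Longrightarrow> G (u, u) \<in> Z"
  shows "\<exists>c d. Q = (\<Prod>j<n. [:- [:c j, d j:], 1:])"
  using assms(1,2,4)
proof (induction n arbitrary: Q)
  case 0
  then obtain e where "Q = [:e:]" using degree_eq_zeroE by blast
  thus ?case using 0 by (simp add: pCons_one)
next
  case (Suc n)
  have "0 < degree Q" using Suc.prems(2) by simp
  then obtain c d where "[:- [:c, d:], 1:] dvd Q"
    using linear_factor_exists[OF Suc.prems(1) _ Z] Suc.prems(3) by blast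
  then obtain R where R: "Q = [:- [:c, d:], 1:] * R" by (elim dvdE)
  have lR: "lead_coeff R = 1" using Suc.prems(1) unfolding R lead_coeff_mult by simp
  hence "R \<noteq> 0" by auto
  hence "degree Q = Suc (degree R)" unfolding R by (subst degree_mult_eq) auto
  hence dR: "degree R = n" using Suc.prems(2) by simp
  have "root_branch Q I y G" if "root_branch R I y G" for I y G
    using that unfolding root_branch_def R poly2_mult by auto
  hence "\<exists>c d. R = (\<Prod>j<n. [:- [:c j, d j:], 1:])"
    using Suc.IH[OF lR dR] Suc.prems(3) by blast
  then obtain c' d' where R': "R = (\<Prod>j<n. [:- [:c' j, d' j:], 1:])" by blast
  have "Q = (\<Prod>j<Suc n. [:- [:(c'(n := c)) j, (d'(n := d)) j:], 1:])"
    unfolding R R' by (simp add: mult.commute)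
  thus ?case by blast
qed

section \<open>Pencils of two matrices of the semigroup\<close>

definition pencil :: "complex mat \<Rightarrow> complex mat \<Rightarrow> complex poly mat" where
  "pencil A B = map_mat (\<lambda>a. [:a:]) A + [:0, 1:] \<cdot>\<^sub>m map_mat (\<lambda>a. [:a:]) B"

lemma pencil_carrier [simp]:
  "A \<in> carrier_mat n n \<Longrightarrow> B \<in> carrier_mat n n \<Longrightarrow> pencil A B \<in> carrier_mat n n"
  unfolding pencil_def by simp

lemma fibre_char_poly_pencil:
  assumes "A \<in> carrier_mat n n" "B \<in> carrier_mat n n"
  shows "fibre u (char_poly (pencil A B)) = char_poly (A + u \<cdot>\<^sub>m B)"
proof -
  have "map_mat (\<lambda>p. poly p u) (pencil A B) = A + u \<cdot>\<^sub>m B"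
    using assms unfolding pencil_def by (intro eq_matI) auto
  thus ?thesis
    using poly_hom.char_poly_hom[OF pencil_carrier[OF assms], of u] unfolding fibre_def by simp
qed

lemma char_poly_pencil_monic:
  assumes "A \<in> carrier_mat n n" "B \<in> carrier_mat n n"
  shows "lead_coeff (char_poly (pencil A B)) = 1" "degree (char_poly (pencil A B)) = n"
  using degree_monic_char_poly[OF pencil_carrier[OF assms]] by auto

lemma poly2_pencil_eigenvalue:
  assumes "A \<in> carrier_mat n n" "B \<in> carrier_mat n n"
  shows "poly2 (char_poly (pencil A B)) x u = 0 \<longleftrightarrow> eigenvalue (A + u \<cdot>\<^sub>m B) x"
  unfolding poly2_def fibre_char_poly_pencil[OF assms]
  by (rule eigenvalue_root_char_poly[symmetric, of _ n]) (use assms in simp)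

lemma eigenvalue_smult:
  fixes M :: "complex mat"
  assumes M: "M \<in> carrier_mat n n" and ev: "eigenvalue M x"
  shows "eigenvalue (c \<cdot>\<^sub>m M) (c * x)"
proof -
  obtain v where v: "v \<in> carrier_vec n" "v \<noteq> 0\<^sub>v n" "M *\<^sub>v v = x \<cdot>\<^sub>v v"
    using M ev unfolding eigenvalue_def eigenvector_def by auto
  have "(c \<cdot>\<^sub>m M) *\<^sub>v v = c \<cdot>\<^sub>v (M *\<^sub>v v)" using M v(1) by (auto intro!: eq_vecI)
  also have "\<dots> = (c * x) \<cdot>\<^sub>v v" unfolding v(3) by (simp add: smult_smult_assoc)
  finally show ?thesis using M v unfolding eigenvalue_def eigenvector_def by auto
qed

lemma finite_eigenvalues:
  fixes M :: "complex mat"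
  assumes M: "M \<in> carrier_mat n n"
  shows "finite {x. eigenvalue M x}" "card {x. eigenvalue M x} \<le> n"
proof -
  have p: "degree (char_poly M) = n" "char_poly M \<noteq> 0" using degree_monic_char_poly[OF M] by auto
  have "{x. eigenvalue M x} = {x. poly (char_poly M) x = 0}" using eigenvalue_root_char_poly[OF M] by auto
  thus "finite {x. eigenvalue M x}" "card {x. eigenvalue M x} \<le> n"
    using poly_roots_finite[OF p(2)] poly_roots_degree[OF p(2)] p(1) by auto
qed

text \<open>Two solutions differ by an integer multiple of 2 pi i / d.\<close>

lemma countable_exp_preimage:
  assumes "d \<noteq> (0 :: nat)"
  shows "countable {z :: complex. exp (of_nat d * z) = c}"
proof (cases "\<exists>z :: complex. exp (of_nat d * z) = c")
  case True
  then obtain z0 :: complex where z0: "exp (of_nat d * z0) = c" by blast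
  have "{z. exp (of_nat d * z) = c} \<subseteq> range (\<lambda>k::int. z0 + of_int (2 * k) * pi * \<i> / of_nat d)"
  proof
    fix z assume "z \<in> {z. exp (of_nat d * z) = c}"
    hence "exp (of_nat d * z) = exp (of_nat d * z0)" using z0 by simp
    then obtain k :: int where "of_nat d * z = of_nat d * z0 + of_int (2 * k) * pi * \<i>"
      unfolding exp_eq by auto
    hence "z = z0 + of_int (2 * k) * pi * \<i> / of_nat d" using assms by (simp add: field_simps)
    thus "z \<in> range (\<lambda>k::int. z0 + of_int (2 * k) * pi * \<i> / of_nat d)" by blast
  qed
  thus ?thesis by (rule countable_subset) simp
qed simp

locale exp_semigroup =
  fixes n :: nat and S :: "complex mat set"
  assumes carrier: "A \<in> S \<Longrightarrow> A \<in> carrier_mat n n"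
    and add_closed: "A \<in> S \<Longrightarrow> B \<in> S \<Longrightarrow> A + B \<in> S"
    and mexp_add: "A \<in> S \<Longrightarrow> B \<in> S \<Longrightarrow> mexp (A + B) = mexp A * mexp B"
begin

lemma mexp_carrier: "A \<in> S \<Longrightarrow> mexp A \<in> carrier_mat n n"
  using carrier unfolding mexp_def by fastforce

lemma mexp_commute: "A \<in> S \<Longrightarrow> B \<in> S \<Longrightarrow> mexp A * mexp B = mexp B * mexp A"
  using mexp_add comm_add_mat[OF carrier carrier] by metis

text \<open>\<open>S\<close> may fail to contain 0, so multiples of \<open>B\<close> are added to an
  element of \<open>S\<close>, which makes s = 0 admissible.\<close>

lemma add_multiple:
  assumes A: "A \<in> S" and B: "B \<in> S"
  shows "A + of_nat s \<cdot>\<^sub>m B \<in> S \<and> mexp (A + of_nat s \<cdot>\<^sub>m B) = mexp A * mexp B ^\<^sub>m s"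
proof (induction s)
  case 0
  have "A + of_nat 0 \<cdot>\<^sub>m B = A" using carrier[OF A] carrier[OF B] by (intro eq_matI) auto
  moreover have "mexp A * mexp B ^\<^sub>m 0 = mexp A" using mexp_carrier[OF A] mexp_carrier[OF B] by simp
  ultimately show ?case using A by metis
next
  case (Suc s)
  have eq: "A + of_nat (Suc s) \<cdot>\<^sub>m B = (A + of_nat s \<cdot>\<^sub>m B) + B"
    using carrier[OF A] carrier[OF B] by (intro eq_matI) (auto simp: algebra_simps)
  have "mexp (A + of_nat (Suc s) \<cdot>\<^sub>m B) = (mexp A * mexp B ^\<^sub>m s) * mexp B"
    unfolding eq using mexp_add Suc B by simp
  also have "\<dots> = mexp A * mexp B ^\<^sub>m Suc s"
    using assoc_mult_mat[OF mexp_carrier[OF A] pow_carrier_mat[OF mexp_carrier[OF B]] mexp_carrier[OF B]]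
    by simp
  finally show ?case unfolding eq using add_closed Suc B by simp
qed

lemma multiple_closed:
  assumes A: "A \<in> S" and k: "k > 0"
  shows "of_nat k \<cdot>\<^sub>m A \<in> S"
proof -
  obtain s where s: "k = Suc s" using k by (metis gr0_implies_Suc)
  have "of_nat k \<cdot>\<^sub>m A = A + of_nat s \<cdot>\<^sub>m A"
    using carrier[OF A] unfolding s by (intro eq_matI) (auto simp: algebra_simps)
  thus ?thesis using add_multiple[OF A A] by simp
qed

text \<open>Each exp (\<theta> s) is \<alpha> \<beta>^s with a pair (\<alpha>, \<beta>) from a set
  of at most n^2 pairs, and there are n^2 + 1 indices. For two indices with the same pair, \<alpha>
  cancels in the quotient.\<close>

lemma eigenvalue_pigeonhole:
  assumes C: "C \<in> S" and B: "B \<in> S"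
    and ev: "\<And>s. s \<le> n * n \<Longrightarrow> eigenvalue (C + of_nat s \<cdot>\<^sub>m B) (\<theta> s)"
  shows "\<exists>s s' \<beta>. s < s' \<and> s' \<le> n * n \<and> eigenvalue (mexp B) \<beta> \<and> exp (\<theta> s' - \<theta> s) = \<beta> ^ (s' - s)"
proof -
  have "\<exists>\<alpha> \<beta>. eigenvalue (mexp C) \<alpha> \<and> eigenvalue (mexp B) \<beta> \<and> exp (\<theta> s) = \<alpha> * \<beta> ^ s" if s: "s \<le> n * n" for s
  proof -
    have "eigenvalue (mexp C * mexp B ^\<^sub>m s) (exp (\<theta> s))"
      using eigenvalue_mexp[OF carrier ev[OF s]] add_multiple[OF C B, of s] by simp
    from eigenvalue_commuting_product[OF mexp_carrier[OF C] mexp_carrier[OF B] mexp_commute[OF C B] this]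
    show ?thesis by blast
  qed
  then obtain \<alpha> \<beta> where ab: "\<And>s. s \<le> n * n \<Longrightarrow> eigenvalue (mexp C) (\<alpha> s)"
    "\<And>s. s \<le> n * n \<Longrightarrow> eigenvalue (mexp B) (\<beta> s)" "\<And>s. s \<le> n * n \<Longrightarrow> exp (\<theta> s) = \<alpha> s * \<beta> s ^ s"
    by metis
  define X where "X = {x. eigenvalue (mexp C) x} \<times> {x. eigenvalue (mexp B) x}"
  have "finite X" "card X \<le> n * n"
    unfolding X_def card_cartesian_product
    using finite_eigenvalues[OF mexp_carrier[OF C]] finite_eigenvalues[OF mexp_carrier[OF B]]
    by (auto intro: mult_le_mono)
  moreover have "(\<lambda>s. (\<alpha> s, \<beta> s)) ` {..n * n} \<subseteq> X" unfolding X_def using ab by auto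
  ultimately have "\<not> inj_on (\<lambda>s. (\<alpha> s, \<beta> s)) {..n * n}"
    by (metis card_atMost card_inj_on_le not_less_eq_eq le_trans)
  then obtain s s' where s: "s < s'" "s' \<le> n * n" "\<alpha> s = \<alpha> s'" "\<beta> s = \<beta> s'"
    unfolding inj_on_def by (metis atMost_iff linorder_neqE_nat prod.inject)
  have "exp (\<theta> s) = \<alpha> s * \<beta> s ^ s" "exp (\<theta> s') = \<alpha> s * \<beta> s ^ s'" using ab(3)[of s] ab(3)[of s'] s by auto
  moreover have "\<beta> s ^ s' = \<beta> s ^ s * \<beta> s ^ (s' - s)" using s by (simp flip: power_add)
  moreover have "exp (\<theta> s) \<noteq> 0" by simp
  ultimately have "exp (\<theta> s' - \<theta> s) = \<beta> s ^ (s' - s)" by (simp add: exp_diff)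
  thus ?thesis using s ab(2)[of s] by (metis less_imp_le le_trans)
qed

text \<open>All values compatible with the conclusion of \<open>eigenvalue_pigeonhole\<close> in the
  limit; \<open>d\<close> is the gap between the two indices.\<close>

definition slopes :: "complex mat \<Rightarrow> complex set" where
  "slopes B = (\<Union>d\<in>{1..n * n}. \<Union>\<beta>\<in>{\<beta>. eigenvalue (mexp B) \<beta>}. {z. exp (of_nat d * z) = \<beta> ^ d})"

lemma countable_slopes: "B \<in> S \<Longrightarrow> countable (slopes B)"
  unfolding slopes_def using finite_eigenvalues(1)[OF mexp_carrier]
  by (intro countable_UN countable_exp_preimage) (auto intro: countable_finite)

text \<open>Along \<open>u\<^sub>s = (\<lfloor>N u\<rfloor> + s) / N\<close> the multiple \<open>N y(u\<^sub>s)\<close> is an eigenvalue of an element of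
  \<open>S\<close>, so the pigeonhole principle applies to each \<open>N\<close>; let \<open>N\<close> tend to infinity.\<close>

lemma branch_slope:
  assumes A: "A \<in> S" and B: "B \<in> S" and a: "0 < a"
    and br: "root_branch (char_poly (pencil A B)) {a<..<b} y G" and u: "u \<in> {a<..<b}"
  shows "G (u, u) \<in> slopes B"
proof -
  note cA = carrier[OF A] and cB = carrier[OF B]
  define I where "I = {a<..<b}"
  define q where "q = (\<lambda>N s :: nat. (real (nat \<lfloor>u * real N\<rfloor>) + real s) / real N)"
  have u0: "u > 0" using a u by auto
  have lim: "(\<lambda>N. q N s) \<longlonglongrightarrow> u" for s
  proof -
    have "\<bar>q N s - u\<bar> \<le> (1 + real s) * inverse (real N)" if N: "N > 0" for N
    proof -
      define L where "L = real (nat \<lfloor>u * real N\<rfloor>)"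
      have "L \<le> u * real N" "u * real N < L + 1" unfolding L_def using u0 by auto
      hence "\<bar>L + real s - u * real N\<bar> \<le> 1 + real s" by linarith
      moreover have "q N s - u = (L + real s - u * real N) / real N"
        unfolding q_def L_def using N by (simp add: field_simps)
      ultimately show ?thesis unfolding divide_inverse[symmetric]
        using divide_right_mono[of _ "1 + real s" "real N"] by (metis abs_divide abs_of_nat of_nat_0_le_iff)
    qed
    hence "\<forall>\<^sub>F N in sequentially. norm (q N s - u) \<le> (1 + real s) * inverse (real N)"
      by (auto intro!: eventually_sequentiallyI[of 1])
    moreover have "(\<lambda>N. (1 + real s) * inverse (real N)) \<longlonglongrightarrow> 0"
      using tendsto_mult_right[OF lim_inverse_n[where 'a=real], of "1 + real s"] by simp
    ultimately have "(\<lambda>N. q N s - u) \<longlonglongrightarrow> 0" by (rule Lim_null_comparison)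
    thus ?thesis by (simp add: LIM_zero_iff)
  qed
  have "\<forall>\<^sub>F N in sequentially. \<forall>s\<in>{..n*n}. q N s \<in> I"
  proof (intro eventually_ball_finite ballI)
    fix s show "\<forall>\<^sub>F N in sequentially. q N s \<in> I"
      by (rule topological_tendstoD[OF lim]) (use u in \<open>auto simp: I_def\<close>)
  qed simp
  moreover have "\<forall>\<^sub>F N in sequentially. (N::nat) > 0" by (rule eventually_gt_at_top)
  ultimately have ev: "\<forall>\<^sub>F N in sequentially. N > 0 \<and> (\<forall>s\<le>n*n. q N s \<in> I)"
    by eventually_elim auto
  define X where "X = {(s, s'). s < s' \<and> s' \<le> n * n} \<times> {\<beta>. eigenvalue (mexp B) \<beta>}"
  have finX: "finite X" unfolding X_def
    by (intro finite_cartesian_product finite_eigenvalues(1)[OF mexp_carrier[OF B]]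
          finite_subset[of _ "{..n*n} \<times> {..n*n}"]) auto
  \<comment> \<open>The index pair and \<beta> found by the pigeonhole principle vary with N. The
    finite product over all candidates vanishes for every large N and is continuous in the
    quotients, so it passes to the limit without choosing a subsequence.\<close>
  define \<Phi> where "\<Phi> = (\<lambda>g. \<Prod>((s, s'), \<beta>)\<in>X. exp (of_nat (s' - s) * g s s') - \<beta> ^ (s' - s))"
  have zero: "\<Phi> (\<lambda>s s'. G (q N s, q N s')) = 0" if N: "N > 0" "\<And>s. s \<le> n * n \<Longrightarrow> q N s \<in> I" for N
  proof -
    define L where "L = nat \<lfloor>u * real N\<rfloor>"
    define C where "C = of_nat N \<cdot>\<^sub>m A + of_nat L \<cdot>\<^sub>m B"
    have C: "C \<in> S" unfolding C_def using add_multiple[OF multiple_closed[OF A N(1)] B] by blast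
    have "eigenvalue (C + of_nat s \<cdot>\<^sub>m B) (of_nat N * y (q N s))" if s: "s \<le> n * n" for s
    proof -
      have "eigenvalue (A + of_real (q N s) \<cdot>\<^sub>m B) (y (q N s))"
        using br N(2)[OF s] unfolding root_branch_def I_def poly2_pencil_eigenvalue[OF cA cB] by blast
      hence "eigenvalue (of_nat N \<cdot>\<^sub>m (A + of_real (q N s) \<cdot>\<^sub>m B)) (of_nat N * y (q N s))"
        using cA cB by (intro eigenvalue_smult[of _ n]) auto
      \<comment> \<open>Scaling by N clears the denominator: N A + (L + s) B has natural
        coefficients.\<close>
      moreover have "of_nat N \<cdot>\<^sub>m (A + of_real (q N s) \<cdot>\<^sub>m B) = C + of_nat s \<cdot>\<^sub>m B"
        unfolding C_def q_def L_def[symmetric]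
        using cA cB N(1) by (intro eq_matI) (auto simp: field_simps)
      ultimately show ?thesis by simp
    qed
    from eigenvalue_pigeonhole[OF C B this] obtain s s' \<beta> where s: "s < s'" "s' \<le> n * n" "eigenvalue (mexp B) \<beta>"
      "exp (of_nat N * y (q N s') - of_nat N * y (q N s)) = \<beta> ^ (s' - s)" by blast
    have "y (q N s') - y (q N s) = of_real (q N s' - q N s) * G (q N s, q N s')"
      using br N(2)[of s] N(2)[of s'] s unfolding root_branch_def I_def by auto
    moreover have "q N s' - q N s = real (s' - s) / real N"
      unfolding q_def using s N(1) by (simp add: field_simps of_nat_diff)
    ultimately have "of_nat N * y (q N s') - of_nat N * y (q N s) = of_nat (s' - s) * G (q N s, q N s')"
      using N(1) by (simp add: right_diff_distrib[symmetric] del: of_real_diff)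
    hence "exp (of_nat (s' - s) * G (q N s, q N s')) - \<beta> ^ (s' - s) = 0" using s(4) by simp
    moreover have "((s, s'), \<beta>) \<in> X" unfolding X_def using s by auto
    ultimately show ?thesis unfolding \<Phi>_def using finX by (intro prod_zero) force+
  qed
  have contG: "continuous_on (I \<times> I) G" using br unfolding root_branch_def I_def by blast
  have limG: "(\<lambda>N. G (q N s, q N s')) \<longlonglongrightarrow> G (u, u)" if "s \<le> n * n" "s' \<le> n * n" for s s'
  proof (rule continuous_on_tendsto_compose[OF contG])
    show "(\<lambda>N. (q N s, q N s')) \<longlonglongrightarrow> (u, u)" by (intro tendsto_intros lim)
    show "(u, u) \<in> I \<times> I" using u unfolding I_def by simp
    show "\<forall>\<^sub>F N in sequentially. (q N s, q N s') \<in> I \<times> I"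
      using ev by eventually_elim (use that in auto)
  qed
  have "(\<lambda>N. \<Phi> (\<lambda>s s'. G (q N s, q N s'))) \<longlonglongrightarrow> \<Phi> (\<lambda>s s'. G (u, u))"
    unfolding \<Phi>_def case_prod_beta
    by (intro tendsto_prod tendsto_diff tendsto_exp tendsto_mult tendsto_const limG) (auto simp: X_def)
  moreover have "(\<lambda>N. \<Phi> (\<lambda>s s'. G (q N s, q N s'))) \<longlonglongrightarrow> 0"
    by (rule tendsto_eventually) (use ev in eventually_elim, use zero in blast)
  ultimately have "\<Phi> (\<lambda>s s'. G (u, u)) = 0" by (rule LIMSEQ_unique)
  then obtain s s' \<beta> where "((s, s'), \<beta>) \<in> X" "exp (of_nat (s' - s) * G (u, u)) = \<beta> ^ (s' - s)"
    unfolding \<Phi>_def using finX by (auto simp: prod_zero_iff case_prod_beta)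
  thus ?thesis unfolding X_def slopes_def by (force intro!: bexI[of _ "s' - s"])
qed

text \<open>The factorisation comes from the countable slopes. To see that d_j is an eigenvalue of
  \<open>B\<close>, pass to the reversed pencil: for w nonzero, B + w A = w (A + B / w) has the
  eigenvalue d_j + w c_j, and this polynomial identity in w extends to w = 0.\<close>

lemma pencil_char_poly:
  assumes A: "A \<in> S" and B: "B \<in> S"
  obtains c d where "\<And>u. char_poly (A + u \<cdot>\<^sub>m B) = (\<Prod>j<n. [:- (c j + u * d j), 1:])"
    "\<And>j. j < n \<Longrightarrow> eigenvalue B (d j)"
proof -
  note cA = carrier[OF A] and cB = carrier[OF B]
  obtain c d where cd: "char_poly (pencil A B) = (\<Prod>j<n. [:- [:c j, d j:], 1:])"
    using bivariate_linear_factors[OF char_poly_pencil_monic[OF cA cB] countable_slopes[OF B]]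
      branch_slope[OF A B] by blast
  have fp: "fibre u (\<Prod>j\<in>J. [:- [:c j, d j:], 1:]) = (\<Prod>j\<in>J. [:- (c j + u * d j), 1:])" if "finite J" for u J
    using that
  proof (induction J rule: finite_induct)
    case empty
    show ?case by (simp add: fibre_def)
  next
    case (insert j J)
    have "fibre u [:- [:c j, d j:], 1:] = [:- (c j + u * d j), 1:]"
      by (simp add: fibre_def poly_hom.map_poly_pCons_hom)
    thus ?case using insert by (simp add: fibre_mult del: mult_pCons_left mult_pCons_right)
  qed
  have char: "char_poly (A + u \<cdot>\<^sub>m B) = (\<Prod>j<n. [:- (c j + u * d j), 1:])" for u
    unfolding fibre_char_poly_pencil[OF cA cB, symmetric] cd by (rule fp) simp
  moreover have "eigenvalue B (d j)" if j: "j < n" for j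
  proof -
    have zero: "poly (poly (char_poly (pencil B A)) [:d j, c j:]) w = 0" if w: "w \<noteq> 0" for w
    proof -
      define M where "M = A + inverse w \<cdot>\<^sub>m B"
      have M: "M \<in> carrier_mat n n" unfolding M_def using cA cB by simp
      have "poly (char_poly M) (c j + inverse w * d j) = 0"
        unfolding M_def char poly_prod
        by (rule prod_zero) (use j in \<open>auto intro!: bexI[of _ j]\<close>)
      hence "eigenvalue M (c j + inverse w * d j)" using eigenvalue_root_char_poly[OF M] by simp
      hence "eigenvalue (w \<cdot>\<^sub>m M) (w * (c j + inverse w * d j))" by (rule eigenvalue_smult[OF M])
      moreover have "w \<cdot>\<^sub>m M = B + w \<cdot>\<^sub>m A" unfolding M_def
        using cA cB w by (intro eq_matI) (auto simp: field_simps)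
      moreover have "w * (c j + inverse w * d j) = poly [:d j, c j:] w" using w by (simp add: field_simps)
      ultimately have "poly2 (char_poly (pencil B A)) (poly [:d j, c j:] w) w = 0"
        using poly2_pencil_eigenvalue[OF cB cA] by simp
      thus ?thesis unfolding poly2_linear .
    qed
    have "infinite (UNIV - {0 :: complex})" by (simp add: infinite_UNIV_char_0)
    moreover have "UNIV - {0} \<subseteq> {w. poly (poly (char_poly (pencil B A)) [:d j, c j:]) w = 0}" using zero by auto
    ultimately have "poly (char_poly (pencil B A)) [:d j, c j:] = 0"
      using poly_roots_finite finite_subset by blast
    hence "poly2 (char_poly (pencil B A)) (poly [:d j, c j:] 0) 0 = 0" unfolding poly2_linear by simp
    hence "eigenvalue (B + 0 \<cdot>\<^sub>m A) (d j)" unfolding poly2_pencil_eigenvalue[OF cB cA] by simp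
    moreover have "B + 0 \<cdot>\<^sub>m A = B" using cA cB by (intro eq_matI) auto
    ultimately show ?thesis by simp
  qed
  ultimately show ?thesis using that by blast
qed

end

section \<open>Functions that are polynomial along every line\<close>

text \<open>Stands in for polynomial functions of several variables: restriction to lines is all
  that the density arguments use, and closure under sums and products is immediate.\<close>

definition line_polynomial :: "((nat \<Rightarrow> complex) \<Rightarrow> complex) \<Rightarrow> bool" where
  "line_polynomial f \<longleftrightarrow> (\<forall>p q. \<exists>P. \<forall>z. f (\<lambda>i. p i + z * q i) = poly P z)"

lemma line_polynomial_const: "line_polynomial (\<lambda>w. c)"
  unfolding line_polynomial_def by (intro allI exI[of _ "[:c:]"]) simp

lemma line_polynomial_coord: "line_polynomial (\<lambda>w. w i)"
  unfolding line_polynomial_def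
proof (intro allI)
  fix p q :: "nat \<Rightarrow> complex"
  show "\<exists>P. \<forall>z. p i + z * q i = poly P z" by (intro exI[of _ "[:p i, q i:]"]) simp
qed

lemma line_polynomial_add:
  assumes "line_polynomial f" "line_polynomial g"
  shows "line_polynomial (\<lambda>w. f w + g w)"
  using assms unfolding line_polynomial_def by (metis poly_add)

lemma line_polynomial_diff:
  assumes "line_polynomial f" "line_polynomial g"
  shows "line_polynomial (\<lambda>w. f w - g w)"
  using assms unfolding line_polynomial_def by (metis poly_diff)

lemma line_polynomial_mult:
  assumes "line_polynomial f" "line_polynomial g"
  shows "line_polynomial (\<lambda>w. f w * g w)"
  using assms unfolding line_polynomial_def by (metis poly_mult)

lemma line_polynomial_sum:
  assumes "\<And>a. a \<in> J \<Longrightarrow> line_polynomial (f a)"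
  shows "line_polynomial (\<lambda>w. \<Sum>a\<in>J. f a w)"
  using assms
  by (induction J rule: infinite_finite_induct) (auto intro: line_polynomial_const line_polynomial_add)

lemma line_polynomial_prod:
  assumes "\<And>a. a \<in> J \<Longrightarrow> line_polynomial (f a)"
  shows "line_polynomial (\<lambda>w. \<Prod>a\<in>J. f a w)"
  using assms
  by (induction J rule: infinite_finite_induct) (auto intro: line_polynomial_const line_polynomial_mult)

lemmas line_polynomial_intros = line_polynomial_const line_polynomial_coord line_polynomial_add
  line_polynomial_diff line_polynomial_mult line_polynomial_sum line_polynomial_prod

text \<open>Join a point where the product over \<open>J\<close> is nonzero to one where the new
  factor is nonzero. On this line both are nonzero univariate polynomials, hence so is their
  product.\<close>

lemma line_polynomial_common_nonzero:
  assumes "finite J" "\<And>a. a \<in> J \<Longrightarrow> line_polynomial (f a)" "\<And>a. a \<in> J \<Longrightarrow> \<exists>w. f a w \<noteq> 0"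
  shows "\<exists>w. (\<Prod>a\<in>J. f a w) \<noteq> 0"
  using assms
proof (induction J rule: finite_induct)
  case (insert b J)
  define g where "g = (\<lambda>w. \<Prod>a\<in>J. f a w)"
  obtain w where w: "g w \<noteq> 0" unfolding g_def using insert by blast
  obtain v where v: "f b v \<noteq> 0" using insert.prems by blast
  have "line_polynomial g" unfolding g_def using insert.prems by (intro line_polynomial_prod) auto
  then obtain P where P: "\<And>z. g (\<lambda>i. w i + z * (v i - w i)) = poly P z"
    unfolding line_polynomial_def by (metis (no_types))
  obtain R where R: "\<And>z. f b (\<lambda>i. w i + z * (v i - w i)) = poly R z"
    using insert.prems(1)[of b] unfolding line_polynomial_def by (metis (no_types) insertI1)
  \<comment> \<open>The line passes through w at z = 0 and through v at z = 1.\<close>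
  have "P \<noteq> 0" using P[of 0] w by auto
  moreover have "R \<noteq> 0" using R[of 1] v by auto
  ultimately have "R * P \<noteq> 0" by simp
  then obtain z where "poly (R * P) z \<noteq> 0" using poly_all_0_iff_0 by blast
  hence "f b (\<lambda>i. w i + z * (v i - w i)) * g (\<lambda>i. w i + z * (v i - w i)) \<noteq> 0"
    unfolding P R by simp
  thus ?case using insert.hyps unfolding g_def by auto
qed simp

text \<open>Coordinates are replaced one at a time: in a single coordinate, a nonzero polynomial has
  finitely many roots and so misses some positive integer.\<close>

lemma line_polynomial_nonzero_at_positive_ints:
  assumes lp: "line_polynomial f" and w: "f w \<noteq> 0"
  shows "\<exists>w. f w \<noteq> 0 \<and> (\<forall>i<m. \<exists>k>0. w i = of_nat k)"
proof (induction m)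
  case 0
  show ?case using w by blast
next
  case (Suc m)
  then obtain w where w: "f w \<noteq> 0" "\<And>i. i < m \<Longrightarrow> \<exists>k>0. w i = of_nat k" by blast
  define v where "v = (\<lambda>z i. (w(m := 0)) i + z * (if i = m then 1 else 0))"
  obtain P where P: "\<And>z. f (v z) = poly P z"
    using lp unfolding line_polynomial_def v_def by (metis (no_types))
  have "v (w m) = w" unfolding v_def by auto
  hence "P \<noteq> 0" using P[of "w m"] w by auto
  hence "finite {z. poly P z = 0}" by (rule poly_roots_finite)
  moreover have "infinite ((of_nat :: nat \<Rightarrow> complex) ` {0<..})"
    by (subst finite_image_iff) (auto intro: inj_onI simp: infinite_Ioi)
  ultimately obtain k :: nat where k: "k > 0" "poly P (of_nat k) \<noteq> 0"
    using finite_subset[of "of_nat ` {0<..}" "{z. poly P z = 0}"] by blast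
  have "\<exists>l>0. v (of_nat k) i = of_nat l" if "i < Suc m" for i
    using that w(2)[of i] k(1) unfolding v_def by (cases "i = m") auto
  thus ?case using k(2) P by metis
qed

section \<open>Linear combinations of several matrices\<close>

text \<open>Given entrywise, so that the empty combination is the n by n zero matrix.\<close>

definition lincomb :: "nat \<Rightarrow> nat \<Rightarrow> (nat \<Rightarrow> complex mat) \<Rightarrow> (nat \<Rightarrow> complex) \<Rightarrow> complex mat" where
  "lincomb n m A t = mat n n (\<lambda>x. \<Sum>i<m. t i * A i $$ x)"

lemma lincomb_carrier [simp]: "lincomb n m A t \<in> carrier_mat n n"
  unfolding lincomb_def by simp

lemma lincomb_Suc:
  assumes "A m \<in> carrier_mat n n"
  shows "lincomb n (Suc m) A t = lincomb n m A t + t m \<cdot>\<^sub>m A m"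
  using assms unfolding lincomb_def by (intro eq_matI) auto

lemma lincomb_zero: "lincomb n m A (\<lambda>_. 0) = 0\<^sub>m n n"
  unfolding lincomb_def by (intro eq_matI) auto

lemma lincomb_add: "lincomb n m A (\<lambda>i. s i + t i) = lincomb n m A s + lincomb n m A t"
  unfolding lincomb_def by (intro eq_matI) (auto simp: sum.distrib algebra_simps)

lemma lincomb_smult: "lincomb n m A (\<lambda>i. c * t i) = c \<cdot>\<^sub>m lincomb n m A t"
  unfolding lincomb_def by (intro eq_matI) (auto simp: sum_distrib_left algebra_simps)

text \<open>The Leibniz expansion makes the value visibly polynomial in the coefficients
  \<open>t\<close> and in \<open>x\<close> together.\<close>

lemma poly_char_poly_lincomb:
  "poly (char_poly (lincomb n m A t)) x =
    (\<Sum>p | p permutes {0..<n}. of_int (sign p) *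
       (\<Prod>i = 0..<n. (if i = p i then x else 0) - (\<Sum>k<m. t k * A k $$ (i, p i))))"
proof -
  define M where "M = lincomb n m A t"
  have M: "M \<in> carrier_mat n n" unfolding M_def by simp
  have "poly (char_poly M) x = det (map_mat (\<lambda>p. poly p x) (char_poly_matrix M))"
    unfolding char_poly_def by (rule comm_ring_hom.hom_det[OF poly_hom.comm_ring_hom_axioms, symmetric])
  also have "\<dots> = (\<Sum>p | p permutes {0..<n}. of_int (sign p) *
       (\<Prod>i = 0..<n. map_mat (\<lambda>p. poly p x) (char_poly_matrix M) $$ (i, p i)))"
    by (rule det_def') (use M in simp)
  also have "\<dots> = (\<Sum>p | p permutes {0..<n}. of_int (sign p) *
       (\<Prod>i = 0..<n. (if i = p i then x else 0) - (\<Sum>k<m. t k * A k $$ (i, p i))))"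
  proof (intro sum.cong prod.cong refl arg_cong2[where f = "(*)"])
    fix p i assume p: "p \<in> {p. p permutes {0..<n}}" and i: "i \<in> {0..<n}"
    have pi: "p i < n" using p i permutes_in_image[of p "{0..<n}" i] by auto
    show "map_mat (\<lambda>p. poly p x) (char_poly_matrix M) $$ (i, p i)
       = (if i = p i then x else 0) - (\<Sum>k<m. t k * A k $$ (i, p i))"
      using i pi M unfolding char_poly_matrix_def M_def lincomb_def by auto
  qed
  finally show ?thesis unfolding M_def .
qed

section \<open>The zero matrix and the matching of linear factorisations\<close>

lemma eigenvalue_zero_mat:
  assumes "eigenvalue (0\<^sub>m n n :: complex mat) x"
  shows "x = 0"
proof -
  obtain v where v: "v \<in> carrier_vec n" "v \<noteq> 0\<^sub>v n" "0\<^sub>m n n *\<^sub>v v = x \<cdot>\<^sub>v v"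
    using assms unfolding eigenvalue_def eigenvector_def by auto
  obtain i where i: "i < n" "v $ i \<noteq> 0"
    using v(1,2) by (metis carrier_vecD eq_vecI index_zero_vec(1,2))
  have "(0\<^sub>m n n *\<^sub>v v) $ i = (x \<cdot>\<^sub>v v) $ i" using v(3) by simp
  thus ?thesis using i v(1) by simp
qed

lemma char_poly_zero_mat_roots:
  assumes "char_poly (0\<^sub>m n n :: complex mat) = (\<Prod>j<n. [:- e j, 1:])" "j < n"
  shows "e j = 0"
proof -
  have "poly (char_poly (0\<^sub>m n n :: complex mat)) (e j) = 0"
    unfolding assms(1) poly_prod by (rule prod_zero) (use assms(2) in \<open>auto intro!: bexI[of _ j]\<close>)
  hence "eigenvalue (0\<^sub>m n n :: complex mat) (e j)"
    using eigenvalue_root_char_poly[of "0\<^sub>m n n :: complex mat" n] by simp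
  thus ?thesis by (rule eigenvalue_zero_mat)
qed

lemma char_poly_zero_mat: "char_poly (0\<^sub>m n n :: complex mat) = (\<Prod>j<n. [:- 0, 1:])"
proof -
  have d: "degree (char_poly (0\<^sub>m n n :: complex mat)) = n" "lead_coeff (char_poly (0\<^sub>m n n :: complex mat)) = 1"
    using degree_monic_char_poly[of "0\<^sub>m n n :: complex mat" n] by auto
  obtain r where r: "char_poly (0\<^sub>m n n :: complex mat) = (\<Prod>j<n. [:- r j, 1:])"
    using complex_poly_decompose'[of "char_poly (0\<^sub>m n n)"] d by (metis smult_1_left)
  have "(\<Prod>j<n. [:- r j, 1:]) = (\<Prod>j<n. [:- 0, 1:])"
    by (rule prod.cong) (use char_poly_zero_mat_roots[OF r] in auto)
  thus ?thesis using r by simp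
qed

lemma proots_prod_linear:
  fixes c :: "nat \<Rightarrow> complex"
  shows "proots (\<Prod>j\<in>J. [:- c j, 1:]) = image_mset c (mset_set J)"
proof (cases "finite J")
  case True
  have "proots (\<Prod>j\<in>J. [:- c j, 1:]) = (\<Sum>j\<in>J. {#c j#})"
    by (subst proots_prod) (auto intro!: sum.cong)
  also have "\<dots> = image_mset c (mset_set J)" using True by (induction J rule: finite_induct) auto
  finally show ?thesis .
qed auto

text \<open>Both products have the same multiset of roots, and equal image multisets differ by a
  permutation of the indices.\<close>

lemma prod_linear_eq_permutes:
  fixes c e :: "nat \<Rightarrow> complex"
  assumes "(\<Prod>j<n. [:- c j, 1:]) = (\<Prod>j<n. [:- e j, 1:])"
  obtains \<pi> where "\<pi> permutes {..<n}" "\<And>j. j < n \<Longrightarrow> e j = c (\<pi> j)"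
proof -
  have "image_mset e (mset_set {..<n}) = image_mset c (mset_set {..<n})"
    unfolding proots_prod_linear[symmetric] assms ..
  then obtain \<pi> where "\<pi> permutes {..<n}" "\<forall>j\<in>{..<n}. e j = c (\<pi> j)"
    using image_mset_eq_implies_permutes[OF finite_lessThan] by blast
  thus ?thesis using that by simp
qed

section \<open>Induction on the number of matrices\<close>

context exp_semigroup
begin

lemma lincomb_positive_closed:
  assumes "\<And>i. i < Suc m \<Longrightarrow> A i \<in> S" "\<And>i. i < Suc m \<Longrightarrow> \<exists>k>0. t i = of_nat k"
  shows "lincomb n (Suc m) A t \<in> S"
  using assms
proof (induction m)
  case 0
  obtain k where k: "k > 0" "t 0 = of_nat k" using 0 by blast
  have "lincomb n (Suc 0) A t = of_nat k \<cdot>\<^sub>m A 0"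
    using carrier[OF 0(1)[of 0]] k unfolding lincomb_def by (intro eq_matI) auto
  thus ?case using multiple_closed k 0 by simp
next
  case (Suc m)
  obtain k where k: "k > 0" "t (Suc m) = of_nat k" using Suc.prems(2)[of "Suc m"] by auto
  have "lincomb n (Suc m) A t \<in> S" using Suc by simp
  moreover have "of_nat k \<cdot>\<^sub>m A (Suc m) \<in> S" using multiple_closed k Suc.prems by simp
  ultimately show ?case
    using add_closed k lincomb_Suc[of A "Suc m" n t] carrier[OF Suc.prems(1)[of "Suc m"]] by simp
qed

text \<open>Take the pencil of \<open>A\<close> with itself and write t A = A + (t - 1) A. At t = 0
  all eigenvalues vanish, which forces c_j = d_j.\<close>

lemma char_poly_smult:
  assumes A: "A \<in> S"
  obtains d where "\<And>t. char_poly (t \<cdot>\<^sub>m A) = (\<Prod>j<n. [:- (t * d j), 1:])"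
proof -
  obtain c d where cd: "\<And>u. char_poly (A + u \<cdot>\<^sub>m A) = (\<Prod>j<n. [:- (c j + u * d j), 1:])"
    using pencil_char_poly[OF A A] by metis
  have t: "char_poly (t \<cdot>\<^sub>m A) = (\<Prod>j<n. [:- (c j + (t - 1) * d j), 1:])" for t
  proof -
    have "t \<cdot>\<^sub>m A = A + (t - 1) \<cdot>\<^sub>m A"
      using carrier[OF A] by (intro eq_matI) (auto simp: algebra_simps)
    thus ?thesis using cd by simp
  qed
  have "0 \<cdot>\<^sub>m A = 0\<^sub>m n n" using carrier[OF A] by (intro eq_matI) auto
  hence "char_poly (0\<^sub>m n n :: complex mat) = (\<Prod>j<n. [:- (c j + (0 - 1) * d j), 1:])" using t[of 0] by simp
  from char_poly_zero_mat_roots[OF this] have "c j = d j" if "j < n" for j using that by simp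
  hence "char_poly (t \<cdot>\<^sub>m A) = (\<Prod>j<n. [:- (t * d j), 1:])" for t
    unfolding t by (intro prod.cong refl) (auto simp: algebra_simps)
  thus ?thesis using that by blast
qed

text \<open>For positive integers \<open>t\<^sub>i\<close> the pencil result supplies the new coefficients \<open>b\<^sub>j\<close>, as
  eigenvalues of the new matrix. They depend on \<open>t\<close> but range over a finite set, so one choice
  works on a Zariski dense set of \<open>t\<close>, hence everywhere.\<close>

lemma char_poly_lincomb_step:
  assumes AS: "\<And>i. i < Suc (Suc m) \<Longrightarrow> A i \<in> S"
    and Y: "\<And>t. char_poly (lincomb n (Suc m) A t) = (\<Prod>j<n. [:- (\<Sum>i<Suc m. t i * Y j i), 1:])"
  shows "\<exists>Y. \<forall>t. char_poly (lincomb n (Suc (Suc m)) A t) = (\<Prod>j<n. [:- (\<Sum>i<Suc (Suc m). t i * Y j i), 1:])"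
proof -
  define M where "M = Suc m"
  define B where "B = A M"
  have B: "B \<in> S" unfolding B_def M_def using AS by simp
  define X where "X = PiE {..<n} (\<lambda>_. {x. eigenvalue B x})"
  have finX: "finite X" unfolding X_def
    using finite_eigenvalues(1)[OF carrier[OF B]] by (intro finite_PiE) auto
  \<comment> \<open>Coordinates up to \<open>M\<close> of \<open>w\<close> are the coefficients;
    coordinate \<open>Suc M\<close> carries the variable of the characteristic polynomial.\<close>
  define D where "D = (\<lambda>b w. poly (char_poly (lincomb n (Suc M) A w)) (w (Suc M))
     - (\<Prod>j<n. w (Suc M) - ((\<Sum>i<M. w i * Y j i) + w M * b j)))"
  have lp: "line_polynomial (D b)" for b
  proof -
    have "line_polynomial (\<lambda>w. if i = k then w (Suc M) else 0)" for i k :: nat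
      by (cases "i = k") (auto intro: line_polynomial_intros)
    thus ?thesis unfolding D_def poly_char_poly_lincomb
      by (intro line_polynomial_intros)
  qed
  have "\<exists>b\<in>X. \<forall>w. D b w = 0"
  proof (rule ccontr)
    assume "\<not> ?thesis"
    hence "\<exists>w. (\<Prod>b\<in>X. D b w) \<noteq> 0"
      using finX lp by (intro line_polynomial_common_nonzero) auto
    moreover have "line_polynomial (\<lambda>w. \<Prod>b\<in>X. D b w)" by (intro line_polynomial_prod lp)
    \<comment> \<open>The first \<open>M\<close> coordinates become positive integers, which puts
      \<open>C\<close> into \<open>S\<close>. The others stay arbitrary: the pencil formula holds
      for every value of \<open>w M\<close>.\<close>
    ultimately obtain w where w: "(\<Prod>b\<in>X. D b w) \<noteq> 0" "\<And>i. i < M \<Longrightarrow> \<exists>k>0. w i = of_nat k"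
      using line_polynomial_nonzero_at_positive_ints by blast
    define C where "C = lincomb n M A w"
    have C: "C \<in> S" unfolding C_def M_def
      by (rule lincomb_positive_closed) (use AS w(2) in \<open>auto simp: M_def\<close>)
    obtain c d where cd: "\<And>u. char_poly (C + u \<cdot>\<^sub>m B) = (\<Prod>j<n. [:- (c j + u * d j), 1:])"
      and d: "\<And>j. j < n \<Longrightarrow> eigenvalue B (d j)"
      using pencil_char_poly[OF C B] by metis
    have "C + 0 \<cdot>\<^sub>m B = C" using carrier[OF B] carrier[OF C] by (intro eq_matI) auto
    \<comment> \<open>The pencil at u = 0 is \<open>C\<close>, so its labelling of eigenvalues
      agrees with that of \<open>Y\<close> up to a permutation.\<close>
    hence "(\<Prod>j<n. [:- c j, 1:]) = (\<Prod>j<n. [:- (\<Sum>i<M. w i * Y j i), 1:])"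
      using cd[of 0] Y[of w] unfolding C_def M_def by simp
    then obtain \<pi> where \<pi>: "\<pi> permutes {..<n}" "\<And>j. j < n \<Longrightarrow> (\<Sum>i<M. w i * Y j i) = c (\<pi> j)"
      using prod_linear_eq_permutes[of c n "\<lambda>j. \<Sum>i<M. w i * Y j i"] by metis
    \<comment> \<open>The slopes are relabelled to match \<open>Y\<close>; \<open>restrict\<close>
      makes the result an element of the extensional function space \<open>X\<close>.\<close>
    define b where "b = restrict (\<lambda>j. d (\<pi> j)) {..<n}"
    have "b \<in> X" unfolding X_def b_def using d permutes_in_image[OF \<pi>(1)] by auto
    have "lincomb n (Suc M) A w = C + w M \<cdot>\<^sub>m B"
      unfolding C_def B_def by (rule lincomb_Suc) (use B carrier in \<open>simp add: B_def\<close>)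
    hence "poly (char_poly (lincomb n (Suc M) A w)) x = (\<Prod>j<n. x - (c j + w M * d j))" for x
      unfolding cd poly_prod by (simp add: cd poly_prod algebra_simps)
    also have "(\<Prod>j<n. x - (c j + w M * d j)) = (\<Prod>j<n. x - (c (\<pi> j) + w M * d (\<pi> j)))" for x
      using prod.permute[OF \<pi>(1), of "\<lambda>j. x - (c j + w M * d j)"] by (simp add: comp_def)
    also have "(\<Prod>j<n. x - (c (\<pi> j) + w M * d (\<pi> j))) = (\<Prod>j<n. x - ((\<Sum>i<M. w i * Y j i) + w M * b j))" for x
      by (intro prod.cong refl) (auto simp: \<pi>(2) b_def)
    finally have "D b w = 0" unfolding D_def by simp
    thus False using w(1) \<open>b \<in> X\<close> finX by (auto simp: prod_zero_iff)
  qed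
  then obtain b where b: "\<And>w. D b w = 0" by blast
  have "char_poly (lincomb n (Suc M) A t) = (\<Prod>j<n. [:- (\<Sum>i<Suc M. t i * ((Y j)(M := b j)) i), 1:])" for t
  proof (rule poly_ext)
    fix x
    define w where "w = t(Suc M := x)"
    have "lincomb n (Suc M) A w = lincomb n (Suc M) A t"
      unfolding lincomb_def w_def by (intro arg_cong2[where f="mat n"] refl ext sum.cong) auto
    moreover have "(\<Sum>i<M. w i * Y j i) + w M * b j = (\<Sum>i<Suc M. t i * ((Y j)(M := b j)) i)" for j
      unfolding w_def by (simp cong: sum.cong_simp)
    ultimately show "poly (char_poly (lincomb n (Suc M) A t)) x
      = poly (\<Prod>j<n. [:- (\<Sum>i<Suc M. t i * ((Y j)(M := b j)) i), 1:]) x"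
      using b[of w] unfolding D_def by (simp add: w_def poly_prod algebra_simps)
  qed
  thus ?thesis unfolding M_def by (intro exI[of _ "\<lambda>j. (Y j)(Suc m := b j)"] allI)
qed

lemma char_poly_lincomb:
  assumes "\<And>i. i < m \<Longrightarrow> A i \<in> S"
  shows "\<exists>Y. \<forall>t. char_poly (lincomb n m A t) = (\<Prod>j<n. [:- (\<Sum>i<m. t i * Y j i), 1:])"
proof (cases m)
  case 0
  have "lincomb n 0 A t = 0\<^sub>m n n" for t unfolding lincomb_def by (intro eq_matI) auto
  thus ?thesis unfolding 0 by (simp add: char_poly_zero_mat)
next
  case (Suc l)
  show ?thesis using assms unfolding Suc
  proof (induction l)
    case 0
    obtain d where d: "\<And>t. char_poly (t \<cdot>\<^sub>m A 0) = (\<Prod>j<n. [:- (t * d j), 1:])"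
      using char_poly_smult[of "A 0"] 0 by auto
    have "lincomb n (Suc 0) A t = t 0 \<cdot>\<^sub>m A 0" for t
      using carrier[of "A 0"] 0 unfolding lincomb_def by (intro eq_matI) auto
    thus ?case using d by (intro exI[of _ "\<lambda>j i. d j"]) simp
  next
    case (Suc l)
    then obtain Y where "\<And>t. char_poly (lincomb n (Suc l) A t) = (\<Prod>j<n. [:- (\<Sum>i<Suc l. t i * Y j i), 1:])"
      by (metis less_SucI)
    from char_poly_lincomb_step[OF Suc.prems this] show ?case by blast
  qed
qed

end

section \<open>Finite generation of the span\<close>

text \<open>Gaussian elimination, one point of \<open>K\<close> at a time, with the generators taken
  from \<open>F\<close> itself. This yields finitely many elements of the semigroup that generate
  its span.\<close>

lemma finite_generating_family:
  fixes F :: "('a \<Rightarrow> complex) set"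
  assumes "finite K"
  shows "\<exists>m A. (\<forall>i<m. A i \<in> F) \<and> (\<forall>f\<in>F. \<exists>t. \<forall>x\<in>K. f x = (\<Sum>i<(m::nat). t i * A i x))"
  using assms
proof (induction K arbitrary: F rule: finite_induct)
  case empty
  show ?case by (intro exI[of _ 0]) auto
next
  case (insert k K)
  show ?case
  proof (cases "\<forall>f\<in>F. f k = 0")
    case True
    obtain m A where A: "\<forall>i<m. A i \<in> F" "\<forall>f\<in>F. \<exists>t. \<forall>x\<in>K. f x = (\<Sum>i<(m::nat). t i * A i x)"
      using insert.IH[of F] by blast
    have "\<exists>t. \<forall>x\<in>insert k K. f x = (\<Sum>i<m. t i * A i x)" if f: "f \<in> F" for f
    proof -
      obtain t where t: "\<forall>x\<in>K. f x = (\<Sum>i<m. t i * A i x)" using A(2) f by blast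
      have "(\<Sum>i<m. t i * A i k) = 0" by (rule sum.neutral) (use A(1) True in auto)
      hence "f k = (\<Sum>i<m. t i * A i k)" using True f by simp
      thus ?thesis using t by blast
    qed
    thus ?thesis using A(1) by blast
  next
    case False
    then obtain g where g: "g \<in> F" "g k \<noteq> 0" by blast
    \<comment> \<open>Subtracting a multiple of the pivot \<open>g\<close> makes every function
      vanish at \<open>k\<close>; the induction hypothesis then handles the remaining
      points.\<close>
    define h where "h = (\<lambda>f x. f x - f k / g k * g x)"
    obtain m A' where A': "\<forall>i<m. A' i \<in> h ` F"
      "\<forall>f\<in>h ` F. \<exists>t. \<forall>x\<in>K. f x = (\<Sum>i<(m::nat). t i * A' i x)"
      using insert.IH[of "h ` F"] by blast
    have "\<forall>i. \<exists>f. i < m \<longrightarrow> f \<in> F \<and> A' i = h f" using A'(1) by blast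
    from choice[OF this] obtain A where A: "\<And>i. i < m \<Longrightarrow> A i \<in> F" "\<And>i. i < m \<Longrightarrow> A' i = h (A i)"
      by blast
    show ?thesis
    proof (intro exI[of _ "Suc m"] exI[of _ "A(m := g)"] conjI ballI allI impI)
      fix i assume "i < Suc m"
      thus "(A(m := g)) i \<in> F" using A(1) g by (cases "i = m") auto
    next
      fix f assume f: "f \<in> F"
      then obtain t where t: "\<And>x. x \<in> K \<Longrightarrow> h f x = (\<Sum>i<m. t i * A' i x)" using A'(2) by blast
      \<comment> \<open>The coefficient of \<open>g\<close> adds up the multiple removed from
        \<open>f\<close> and those removed from the generators \<open>A i\<close>.\<close>
      define e where "e = f k / g k - (\<Sum>i<m. t i * (A i k / g k))"
      show "\<exists>t. \<forall>x\<in>insert k K. f x = (\<Sum>i<Suc m. t i * (A(m := g)) i x)"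
      proof (intro exI[of _ "t(m := e)"] ballI)
        fix x assume x: "x \<in> insert k K"
        have hx: "h f x = (\<Sum>i<m. t i * A' i x)"
        proof (cases "x = k")
          case True
          have "h f k = 0" for f unfolding h_def using g(2) by simp
          thus ?thesis using A(2) True by simp
        qed (use t x in auto)
        have "f x = h f x + f k / g k * g x" unfolding h_def by simp
        also have "h f x = (\<Sum>i<m. t i * (A i x - A i k / g k * g x))"
          unfolding hx using A(2) by (intro sum.cong refl) (simp add: h_def)
        also have "\<dots> = (\<Sum>i<m. t i * A i x) - (\<Sum>i<m. t i * (A i k / g k)) * g x"
          by (simp add: algebra_simps sum_subtractf sum_distrib_left)
        finally have "f x = (\<Sum>i<m. t i * A i x) + e * g x" unfolding e_def by (simp add: algebra_simps)
        thus "f x = (\<Sum>i<Suc m. (t(m := e)) i * (A(m := g)) i x)" by (simp cong: sum.cong_simp)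
      qed
    qed
  qed
qed

lemma mspan_finite_generators:
  assumes S: "S \<subseteq> carrier_mat n n"
  obtains m A where "\<And>i. i < m \<Longrightarrow> A i \<in> S" "\<And>X. X \<in> mspan n S \<Longrightarrow> \<exists>t. X = lincomb n m A t"
proof -
  obtain m A' where A': "\<forall>i<m. A' i \<in> (\<lambda>M x. M $$ x) ` S"
    "\<forall>f\<in>(\<lambda>M x. M $$ x) ` S. \<exists>t. \<forall>x\<in>{..<n} \<times> {..<n}. f x = (\<Sum>i<(m::nat). t i * A' i x)"
    using finite_generating_family[of "{..<n} \<times> {..<n}" "(\<lambda>M x. M $$ x) ` S"] by auto
  have "\<forall>i. \<exists>M. i < m \<longrightarrow> M \<in> S \<and> A' i = (\<lambda>x. M $$ x)" using A'(1) by blast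
  from choice[OF this] obtain A where A: "\<And>i. i < m \<Longrightarrow> A i \<in> S" "\<And>i. i < m \<Longrightarrow> A' i = (\<lambda>x. A i $$ x)"
    by blast
  have gen: "\<exists>t. M = lincomb n m A t" if M: "M \<in> S" for M
  proof -
    obtain t where t: "\<And>x. x \<in> {..<n} \<times> {..<n} \<Longrightarrow> M $$ x = (\<Sum>i<m. t i * A' i x)"
      using A'(2) M by blast
    have "M $$ (a, b) = (\<Sum>i<m. t i * A i $$ (a, b))" if "a < n" "b < n" for a b
      using t[of "(a, b)"] that A(2) by simp
    hence "M = lincomb n m A t"
      using S M unfolding lincomb_def by (intro eq_matI) auto
    thus ?thesis by blast
  qed
  have "\<exists>t. X = lincomb n m A t" if "X \<in> mspan n S" for X
    using that
  proof (induction rule: mspan.induct)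
    case zero
    show ?case using lincomb_zero[of n m A] by metis
  next
    case (add M X c)
    obtain s t where "M = lincomb n m A s" "X = lincomb n m A t" using add gen by blast
    hence "c \<cdot>\<^sub>m M + X = lincomb n m A (\<lambda>i. c * s i + t i)"
      unfolding lincomb_add lincomb_smult by simp
    thus ?case by blast
  qed
  thus ?thesis using that A(1) by blast
qed

section \<open>The linear forms on the span\<close>

theorem mainTheorem11:
  fixes n :: nat and S :: "complex mat set"
  assumes "S \<subseteq> carrier_mat n n"
    and "\<forall>A\<in>S. \<forall>B\<in>S. A + B \<in> S"
    and "\<forall>A\<in>S. \<forall>B\<in>S. mexp (A + B) = mexp A * mexp B"
  shows "property_L n (mspan n S)"
proof -
  interpret exp_semigroup n S by unfold_locales (use assms in auto)
  obtain m A where AS: "\<And>i. i < m \<Longrightarrow> A i \<in> S"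
    and gen: "\<And>X. X \<in> mspan n S \<Longrightarrow> \<exists>t. X = lincomb n m A t"
    using mspan_finite_generators[OF assms(1)] by metis
  obtain Y where Y: "\<And>t. char_poly (lincomb n m A t) = (\<Prod>j<n. [:- (\<Sum>i<m. t i * Y j i), 1:])"
    using char_poly_lincomb[of m A, OF AS] by blast
  define L where "L = (\<lambda>t j. \<Sum>i<m. t i * Y j i)"
  have L_add: "L (\<lambda>i. s i + t i) j = L s j + L t j" for s t j
    unfolding L_def by (simp add: algebra_simps sum.distrib)
  have L_smult: "L (\<lambda>i. c * t i) j = c * L t j" for c t j
    unfolding L_def by (simp add: algebra_simps sum_distrib_left)
  \<comment> \<open>The coefficients \<open>s - t\<close> give the zero matrix, all of whose
    eigenvalues, among them L(s) - L(t), are zero.\<close>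
  have wd: "L s j = L t j" if eq: "lincomb n m A s = lincomb n m A t" and j: "j < n" for s t j
  proof -
    have "lincomb n m A (\<lambda>i. s i + (-1) * t i) = 0\<^sub>m n n"
      unfolding lincomb_add lincomb_smult eq by (intro eq_matI) (auto simp: lincomb_def)
    hence "char_poly (0\<^sub>m n n) = (\<Prod>j<n. [:- L (\<lambda>i. s i + (-1) * t i) j, 1:])"
      using Y[of "\<lambda>i. s i + (-1) * t i"] unfolding L_def by simp
    from char_poly_zero_mat_roots[OF this j] have "L (\<lambda>i. s i + (-1) * t i) j = 0" .
    thus ?thesis unfolding L_add L_smult by simp
  qed
  \<comment> \<open>The choice of a coefficient vector is harmless: by \<open>wd\<close> the value
    does not depend on it.\<close>
  define f where "f = (\<lambda>j X. L (SOME t. X = lincomb n m A t) j)"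
  have f: "f j (lincomb n m A t) = L t j" if "j < n" for j t
  proof -
    have "lincomb n m A t = lincomb n m A (SOME s. lincomb n m A t = lincomb n m A s)"
      by (rule someI[of "\<lambda>s. lincomb n m A t = lincomb n m A s"]) (rule refl)
    thus ?thesis unfolding f_def using wd that by metis
  qed
  have "linear_form_on (mspan n S) (f j)" if j: "j < n" for j
    unfolding linear_form_on_def
  proof (intro conjI ballI allI)
    fix M X assume "M \<in> mspan n S" "X \<in> mspan n S"
    then obtain s t where "M = lincomb n m A s" "X = lincomb n m A t" using gen by metis
    thus "f j (M + X) = f j M + f j X"
      by (simp add: f[OF j] L_add flip: lincomb_add)
  next
    fix M c assume "M \<in> mspan n S"
    then obtain t where "M = lincomb n m A t" using gen by metis
    thus "f j (c \<cdot>\<^sub>m M) = c * f j M"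
      by (simp add: f[OF j] L_smult flip: lincomb_smult)
  qed
  moreover have "char_poly M = (\<Prod>j<n. [:- f j M, 1:])" if M: "M \<in> mspan n S" for M
  proof -
    obtain t where t: "M = lincomb n m A t" using gen M by metis
    show ?thesis unfolding t Y
      by (intro prod.cong refl) (simp add: f L_def)
  qed
  ultimately show ?thesis unfolding property_L_def by blast
qed



end
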